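(* Let $M$ be a complete locally compact CAT(0)-space and let $X$ be an asymptotic cone of $M$. Let $k\ge 1$, let $\gamma$ be a $k$-flat of $M$ (possibly a geodesic, i.e. $k=1$), and let $\gamma_\omega$ be its limit in $X$. Suppose that there exists a flattening sequence of maps for $\gamma_\omega$. Then the original $k$-flat $\gamma$ bounds a $(k+1)$-dimensional half-flat in $M$.
   Context: Flats and half-flats. A $k$-flat ($k\ge1$) in a CAT(0)-space is an isometrically embedded copy of the standard Euclidean space $\mathbb{R}^k$ (for $k=1$: a bi-infinite geodesic). A $(k+1)$-dimensional half-flat is an isometrically embedded copy of $\mathbb{R}^{k}\times[0,\infty)$. A $k$-flat $\gamma$ bounds a $(k+1)$-dimensional half-flat if there is an isometric embedding of $\mathbb{R}^k\times[0,\infty)$ into the space mapping $\mathbb{R}^k\times\{0\}$ onto $\gamma$. Asymptotic cones. Let $\omega$ be a non-principal ultrafilter on $\mathbb{N}$, let $(M,d,* )$ be a pointed metric space, and let $\lambda_j\in(0,\infty)$ be a sequence of scaling factors with $\omega\lim\lambda_j=\infty$. For sequences $\{x_j\},\{y_j\}$ in $M$ set $d_\omega(\{x_j\},\{y_j\})=\omega\lim d(x_j,y_j)/\lambda_j\in[0,\infty]$. The asymptotic cone $X=\mathrm{Cone}(M)$ is the set of sequences $\{x_j\}$ with $d_\omega(\{x_j\},\{*\})<\infty$, modulo identifying sequences at $d_\omega$-distance $0$, with metric $d_\omega$ (also written $d$) and basepoint (also denoted $*$) the class of the constant sequence $\{*\}$. "An asymptotic cone" means one obtained from some choice of basepoint,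 scaling sequence and ultrafilter. If $M$ is CAT(0), so is $X$. If $\gamma\subset M$ is a $k$-flat, its limit $\gamma_\omega\subset X$ is the set of points of $X$ represented by sequences of points in $\gamma$; it is a $k$-flat of $X$ and contains the basepoint $*$ of $X$. Flattening sequences. Let $\pi:X\to\gamma_\omega$ be the nearest point projection, and let $\mathbb{D}^k$ be the closed $k$-disk with boundary $S^{k-1}$. A flattening sequence for $\gamma_\omega$ is a sequence of continuous maps $(f_r)_{r\in\mathbb{N}}$, $f_r:\mathbb{D}^k\to X$, such that: (1) the diameter of $f_r(\mathbb{D}^k)$ is smaller than one; (2) the image of $\pi\circ f_r$ contains an open neighborhood of $*$ in $\gamma_\omega$; (3) the image of the restriction of $\pi\circ f_r$ to $\partial\mathbb{D}^k=S^{k-1}$ does not contain $*$, and this restriction represents a non-zero element of $\pi_{k-1}(\gamma_\omega\setminus\{*\})\cong\mathbb{Z}$ (for $k=1$: the two endpoints of $\mathbb{D}^1$ are sent to different components of $\gamma_\omega\setminus\{*\}$); (4) there is a constant $D>0$, independent of $r$, such that $\inf_{x\in\mathbb{D}^k}d(f_r(x),\gamma_\omega)\ge D\cdot r$ for all $r$. *)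

theory Defs
  imports "HOL-Analysis.Analysis"
begin

section \<open>CAT(0) spaces\<close>

definition geodesic_from_to :: "'a set \<Rightarrow> ('a \<Rightarrow> 'a \<Rightarrow> real) \<Rightarrow> 'a \<Rightarrow> 'a \<Rightarrow> (real \<Rightarrow> 'a) \<Rightarrow> bool"
  where "geodesic_from_to M d p q c \<longleftrightarrow>
    c ` {0..d p q} \<subseteq> M \<and> c 0 = p \<and> c (d p q) = q \<and>
    (\<forall>s\<in>{0..d p q}. \<forall>t\<in>{0..d p q}. d (c s) (c t) = \<bar>s - t\<bar>)"

definition geodesic_space :: "'a set \<Rightarrow> ('a \<Rightarrow> 'a \<Rightarrow> real) \<Rightarrow> bool"
  where "geodesic_space M d \<longleftrightarrow>
    Metric_space M d \<and> (\<forall>p\<in>M. \<forall>q\<in>M. \<exists>c. geodesic_from_to M d p q c)"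

text \<open>
  The primed points form a comparison triangle in the Euclidean plane, and \<open>x'\<close>, \<open>y'\<close> are the
  comparison points of \<open>x = c s\<close> and \<open>y = c' t\<close>. Only the sides issuing from \<open>p\<close> occur: any two
  distinct sides of a triangle share a vertex, and \<open>p\<close>, \<open>q\<close>, \<open>r\<close> are arbitrary.
\<close>

definition CAT0_space :: "'a set \<Rightarrow> ('a \<Rightarrow> 'a \<Rightarrow> real) \<Rightarrow> bool"
  where "CAT0_space M d \<longleftrightarrow> geodesic_space M d \<and>
    (\<forall>p\<in>M. \<forall>q\<in>M. \<forall>r\<in>M. \<forall>c c'. \<forall>p' q' r' :: real^2.
       geodesic_from_to M d p q c \<and> geodesic_from_to M d p r c' \<and>
       dist p' q' = d p q \<and> dist q' r' = d q r \<and> dist p' r' = d p r \<longrightarrow>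
       (\<forall>s\<in>{0..d p q}. \<forall>t\<in>{0..d p r}.
          \<forall>x'\<in>closed_segment p' q'. \<forall>y'\<in>closed_segment p' r'.
            dist p' x' = s \<and> dist p' y' = t \<longrightarrow> d (c s) (c' t) \<le> dist x' y'))"


section \<open>Flats and half-flats\<close>

definition isometric_embedding ::
    "'b::metric_space set \<Rightarrow> 'a set \<Rightarrow> ('a \<Rightarrow> 'a \<Rightarrow> real) \<Rightarrow> ('b \<Rightarrow> 'a) \<Rightarrow> bool"
  where "isometric_embedding A M d \<phi> \<longleftrightarrow>
    \<phi> ` A \<subseteq> M \<and> (\<forall>u\<in>A. \<forall>v\<in>A. d (\<phi> u) (\<phi> v) = dist u v)"

text \<open>The dimension is \<open>CARD('k)\<close>, an arbitrary integer that is at least one.\<close>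

definition is_flat :: "'k::finite itself \<Rightarrow> 'a set \<Rightarrow> ('a \<Rightarrow> 'a \<Rightarrow> real) \<Rightarrow> 'a set \<Rightarrow> bool"
  where "is_flat _ M d \<gamma> \<longleftrightarrow>
    (\<exists>\<phi> :: real^'k \<Rightarrow> 'a. isometric_embedding UNIV M d \<phi> \<and> range \<phi> = \<gamma>)"

text \<open>The metric of the product type \<open>real^'k \<times> real\<close> is the Euclidean one.\<close>

definition bounds_half_flat ::
    "'k::finite itself \<Rightarrow> 'a set \<Rightarrow> ('a \<Rightarrow> 'a \<Rightarrow> real) \<Rightarrow> 'a set \<Rightarrow> bool"
  where "bounds_half_flat _ M d \<gamma> \<longleftrightarrow>
    (\<exists>\<phi> :: (real^'k) \<times> real \<Rightarrow> 'a.
       isometric_embedding (UNIV \<times> {0..}) M d \<phi> \<and> \<phi> ` (UNIV \<times> {0}) = \<gamma>)"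


section \<open>Asymptotic cones\<close>

definition nonprincipal_ultrafilter :: "'i filter \<Rightarrow> bool"
  where "nonprincipal_ultrafilter \<omega> \<longleftrightarrow>
    \<omega> \<noteq> bot \<and> (\<forall>P. eventually P \<omega> \<or> eventually (\<lambda>i. \<not> P i) \<omega>) \<and>
    (\<forall>i. \<not> eventually (\<lambda>j. j = i) \<omega>)"

text \<open>
  The parameters are the carrier \<open>M\<close>, the metric \<open>d\<close>, the basepoint \<open>b\<close>, the scaling factors \<open>l\<close>
  and the ultrafilter \<open>\<omega>\<close>. Limits along an ultrafilter always exist in the compact space
  \<open>ennreal\<close>.
\<close>

definition cone_seq_dist ::
    "('a \<Rightarrow> 'a \<Rightarrow> real) \<Rightarrow> (nat \<Rightarrow> real) \<Rightarrow> nat filter \<Rightarrow> (nat \<Rightarrow> 'a) \<Rightarrow> (nat \<Rightarrow> 'a) \<Rightarrow> ennreal"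
  where "cone_seq_dist d l \<omega> x y = Lim \<omega> (\<lambda>j. ennreal (d (x j) (y j) / l j))"

definition cone_seqs ::
    "'a set \<Rightarrow> ('a \<Rightarrow> 'a \<Rightarrow> real) \<Rightarrow> 'a \<Rightarrow> (nat \<Rightarrow> real) \<Rightarrow> nat filter \<Rightarrow> (nat \<Rightarrow> 'a) set"
  where "cone_seqs M d b l \<omega> = {x. range x \<subseteq> M \<and> cone_seq_dist d l \<omega> x (\<lambda>_. b) < \<infinity>}"

definition cone_rel ::
    "'a set \<Rightarrow> ('a \<Rightarrow> 'a \<Rightarrow> real) \<Rightarrow> 'a \<Rightarrow> (nat \<Rightarrow> real) \<Rightarrow> nat filter \<Rightarrow> (nat \<Rightarrow> 'a) rel"
  where "cone_rel M d b l \<omega> =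
    {(x, y). x \<in> cone_seqs M d b l \<omega> \<and> y \<in> cone_seqs M d b l \<omega> \<and> cone_seq_dist d l \<omega> x y = 0}"

definition asymptotic_cone ::
    "'a set \<Rightarrow> ('a \<Rightarrow> 'a \<Rightarrow> real) \<Rightarrow> 'a \<Rightarrow> (nat \<Rightarrow> real) \<Rightarrow> nat filter \<Rightarrow> (nat \<Rightarrow> 'a) set set"
  where "asymptotic_cone M d b l \<omega> = cone_seqs M d b l \<omega> // cone_rel M d b l \<omega>"

text \<open>The choice of representatives does not matter.\<close>

definition cone_dist ::
    "('a \<Rightarrow> 'a \<Rightarrow> real) \<Rightarrow> (nat \<Rightarrow> real) \<Rightarrow> nat filter \<Rightarrow> (nat \<Rightarrow> 'a) set \<Rightarrow> (nat \<Rightarrow> 'a) set \<Rightarrow> real"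
  where "cone_dist d l \<omega> A B =
    enn2real (cone_seq_dist d l \<omega> (SOME x. x \<in> A) (SOME y. y \<in> B))"

definition cone_base ::
    "'a set \<Rightarrow> ('a \<Rightarrow> 'a \<Rightarrow> real) \<Rightarrow> 'a \<Rightarrow> (nat \<Rightarrow> real) \<Rightarrow> nat filter \<Rightarrow> (nat \<Rightarrow> 'a) set"
  where "cone_base M d b l \<omega> = cone_rel M d b l \<omega> `` {\<lambda>_. b}"

definition cone_limit ::
    "'a set \<Rightarrow> ('a \<Rightarrow> 'a \<Rightarrow> real) \<Rightarrow> 'a \<Rightarrow> (nat \<Rightarrow> real) \<Rightarrow> nat filter \<Rightarrow> 'a set \<Rightarrow> (nat \<Rightarrow> 'a) set set"
  where "cone_limit M d b l \<omega> S = {A \<in> asymptotic_cone M d b l \<omega>. \<exists>x\<in>A. range x \<subseteq> S}"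


section \<open>Flattening sequences\<close>

definition nearest_point :: "('a \<Rightarrow> 'a \<Rightarrow> real) \<Rightarrow> 'a set \<Rightarrow> 'a \<Rightarrow> 'a"
  where "nearest_point d S x = arg_min_on (d x) S"

text \<open>
  For \<open>k = CARD('k) \<ge> 2\<close> the class of \<open>g\<close> in the homotopy group of dimension \<open>k - 1\<close> of \<open>Y\<close>, based
  at \<open>g p\<close>, is non-zero if \<open>g\<close> is not homotopic to the constant map by a homotopy that fixes the
  value at \<open>p\<close>. On the sphere, this does not depend on \<open>p\<close>. For \<open>k = 1\<close> the sphere consists of the
  two endpoints of the disk.
\<close>

definition homotopically_nonzero :: "'b topology \<Rightarrow> (real^'k::finite \<Rightarrow> 'b) \<Rightarrow> bool"
  where "homotopically_nonzero Y g \<longleftrightarrow>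
    continuous_map (top_of_set (sphere 0 1)) Y g \<and>
    (if CARD('k) = 1
     then \<forall>u\<in>sphere 0 1. \<forall>v\<in>sphere 0 1. u \<noteq> v \<longrightarrow> \<not> connected_component_of Y (g u) (g v)
     else \<exists>p\<in>sphere 0 1. \<not> homotopic_with (\<lambda>h. h p = g p) (top_of_set (sphere 0 1)) Y g (\<lambda>_. g p))"

text \<open>
  The set \<open>F\<close> is the flat, \<open>b \<in> F\<close> the basepoint of the metric space \<open>(X, d)\<close>. The supremum is
  the diameter of the image; it is taken over a bounded set, since \<open>f r\<close> is continuous on the
  compact disk. Starting the index at zero is harmless, as the last condition is then void.
\<close>

definition flattening_sequence ::
    "'b set \<Rightarrow> ('b \<Rightarrow> 'b \<Rightarrow> real) \<Rightarrow> 'b \<Rightarrow> 'b set \<Rightarrow> (nat \<Rightarrow> real^'k::finite \<Rightarrow> 'b) \<Rightarrow> bool"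
  where "flattening_sequence X d b F f \<longleftrightarrow>
    (let T = Metric_space.mtopology X d; \<pi> = nearest_point d F; D = cball 0 1 in
      (\<forall>r. continuous_map (top_of_set D) T (f r)) \<and>
      (\<forall>r. (SUP (u, v)\<in>D \<times> D. d (f r u) (f r v)) < 1) \<and>
      (\<forall>r. \<exists>U. openin (subtopology T F) U \<and> b \<in> U \<and> U \<subseteq> (\<pi> \<circ> f r) ` D) \<and>
      (\<forall>r. b \<notin> (\<pi> \<circ> f r) ` sphere 0 1 \<and>
           homotopically_nonzero (subtopology T (F - {b})) (\<pi> \<circ> f r)) \<and>
      (\<exists>C>0. \<forall>r. C * real r \<le> (INF u\<in>D. INF p\<in>F. d (f r u) p)))"

end

theory Submission
  imports Defs
begin

text \<open>
  A disk \<open>f r\<close> of a flattening sequence has diameter less than one, while its height over the limit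
  flat is at least \<open>C * r\<close>. If it is brought down to the space at scale \<open>L\<close>, it becomes a disk of
  diameter about \<open>L\<close> and of height about \<open>C * r * L\<close> over the flat \<open>\<gamma>\<close>. Its boundary winds around
  the base point at a distance proportional to \<open>L\<close>, so the projection of the disk covers an
  arbitrarily large ball \<open>B\<close> of \<open>\<gamma>\<close> when \<open>L\<close> is large
  (\<open>distant_points_below_essential_disk\<close>). Thus each point of \<open>B\<close> is the foot of a perpendicular to
  \<open>\<gamma>\<close> whose upper end lies on the disk. The upper ends are close in comparison with the lengths; by
  convexity of the metric, the perpendiculars are almost parallel at bounded height
  (\<open>nearly_parallel_perpendiculars\<close>).

  A complete locally compact CAT(0) space has compact closed balls (\<open>Hopf_Rinow\<close>). So the
  perpendiculars converge, as \<open>r\<close> and \<open>B\<close> grow, to rays that are perpendicular to \<open>\<gamma>\<close> at all of its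
  points and parallel to each other. Rectangles between such rays are flat, because equality holds
  in the comparison inequalities (\<open>parallel_perpendicular_rays_span_half_flat\<close>). The rays together
  form the half-flat.

  The disk in the cone consists of classes of sequences and does not descend to the space as a
  continuous map. Continuity matters, since it is used to show that the projection covers every
  point of \<open>B\<close>. Only a fine net of the disk is lifted, and barycentres, which depend on their
  weights in a Lipschitz way, interpolate between the lifted points (\<open>continuous_interpolation\<close>).
  That the projection covers \<open>B\<close> then follows from the extension property of nullhomotopic maps of
  spheres (\<open>essential_boundary_imp_zero\<close>).
\<close>

section \<open>Limits along ultrafilters\<close>

lemma ultrafilter_limit_in_compact:
  assumes \<omega>: "nonprincipal_ultrafilter \<omega>" and K: "compactin X K"
    and ev: "eventually (\<lambda>i. g i \<in> K) \<omega>"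
  obtains L where "L \<in> K" "limitin X g L \<omega>"
proof (rule ccontr)
  assume contr: "\<not> thesis"
  have "\<exists>U. openin X U \<and> L \<in> U \<and> eventually (\<lambda>i. g i \<notin> U) \<omega>" if "L \<in> K" for L
  proof -
    have "\<not> limitin X g L \<omega>" using contr that \<open>\<And>L. \<lbrakk>L \<in> K; limitin X g L \<omega>\<rbrakk> \<Longrightarrow> thesis\<close> by blast
    moreover have "L \<in> topspace X" using K that compactin_subset_topspace by blast
    ultimately show ?thesis
      using \<omega> unfolding limitin_def nonprincipal_ultrafilter_def by blast
  qed
  then obtain U where U: "\<And>L. L \<in> K \<Longrightarrow> openin X (U L) \<and> L \<in> U L \<and> eventually (\<lambda>i. g i \<notin> U L) \<omega>"
    by metis
  then have "(\<forall>V\<in>U ` K. openin X V) \<and> K \<subseteq> \<Union>(U ` K)" by blast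
  then obtain \<F> where F: "finite \<F>" "\<F> \<subseteq> U ` K" "K \<subseteq> \<Union>\<F>"
    using K unfolding compactin_def by metis
  have "eventually (\<lambda>i. \<forall>V\<in>\<F>. g i \<notin> V) \<omega>"
    using F U by (intro eventually_ball_finite) auto
  with ev have "eventually (\<lambda>i. False) \<omega>"
    by eventually_elim (use F in blast)
  then show False using \<omega> by (simp add: nonprincipal_ultrafilter_def trivial_limit_def)
qed

lemma ultrafilter_tendsto_compact:
  fixes K :: "'b::topological_space set"
  assumes "nonprincipal_ultrafilter \<omega>" "compact K" "eventually (\<lambda>i. g i \<in> K) \<omega>"
  obtains L where "L \<in> K" "(g \<longlongrightarrow> L) \<omega>"
  using ultrafilter_limit_in_compact[of \<omega> euclidean K g] assms
  by (metis compactin_euclidean_iff limitin_canonical_iff)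

lemma nonprincipal_ultrafilter_ge:
  assumes "nonprincipal_ultrafilter (\<omega> :: nat filter)"
  shows "eventually (\<lambda>n. n \<ge> N) \<omega>"
proof -
  have "eventually (\<lambda>n. n \<noteq> i) \<omega>" for i
    using assms unfolding nonprincipal_ultrafilter_def by metis
  then have "eventually (\<lambda>n. \<forall>i\<in>{..<N}. n \<noteq> i) \<omega>"
    by (intro eventually_ball_finite) auto
  then show ?thesis by eventually_elim (use not_less in auto)
qed

lemma nonprincipal_ultrafilter_le_sequentially:
  "nonprincipal_ultrafilter \<omega> \<Longrightarrow> \<omega> \<le> sequentially"
  by (simp add: le_sequentially nonprincipal_ultrafilter_ge)

section \<open>Inequalities in CAT(0) spaces\<close>

lemma comparison_triangle_exists:
  fixes A B C :: real
  assumes "0 \<le> A" "0 \<le> B" "0 \<le> C" "A \<le> B + C" "B \<le> A + C" "C \<le> A + B"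
  obtains p q r :: "real^2" where "dist p q = A" "dist q r = C" "dist p r = B"
proof (cases "A = 0")
  case True
  then have "B = C" using assms by auto
  moreover have "dist (0::real^2) (B *\<^sub>R axis 1 1) = B" using assms by (simp add: dist_norm)
  ultimately show ?thesis using that[of 0 0 "B *\<^sub>R axis 1 1"] True by auto
next
  case False
  with assms have "A > 0" by simp
  define u where "u = (A\<^sup>2 + B\<^sup>2 - C\<^sup>2) / (2*A)"
  have uA: "2*A*u = A\<^sup>2 + B\<^sup>2 - C\<^sup>2" using \<open>A>0\<close> by (simp add: u_def)
  have "\<bar>u\<bar> \<le> B"
  proof (rule abs_leI)
    have "C\<^sup>2 \<ge> (A - B)\<^sup>2" using assms by (metis abs_le_square_iff abs_of_nonneg abs_le_iff diff_le_eq minus_diff_eq add.commute)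
    then have "2*A*u \<le> 2*A*B" unfolding uA by (simp add: power2_eq_square algebra_simps)
    then show "u \<le> B" using \<open>A>0\<close> by simp
    have "C\<^sup>2 \<le> (A + B)\<^sup>2" using assms by (intro power_mono) auto
    then have "2*A*(-u) \<le> 2*A*B" using uA by (simp add: power2_eq_square algebra_simps)
    then show "-u \<le> B" using \<open>A>0\<close> by (simp only: mult_le_cancel_left_pos) 
  qed
  then have le: "u\<^sup>2 \<le> B\<^sup>2" using abs_le_square_iff assms(2) by fastforce
  define r :: "real^2" where "r = vector [u, sqrt (B\<^sup>2 - u\<^sup>2)]"
  define q :: "real^2" where "q = vector [A, 0]"
  have "dist 0 q = A" using assms
    by (simp add: q_def dist_norm norm_vec_def L2_set_def UNIV_2)
  moreover have "dist 0 r = B" using le assms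
    by (simp add: r_def dist_norm norm_vec_def L2_set_def UNIV_2)
  moreover have "(A - u)\<^sup>2 + (B\<^sup>2 - u\<^sup>2) = C\<^sup>2"
    using uA by (simp add: power2_eq_square algebra_simps)
  then have "dist q r = C" using le assms
    by (simp add: q_def r_def dist_vec_def L2_set_def UNIV_2 dist_real_def)
  ultimately show ?thesis using that by blast
qed

text \<open>
  Stewart's theorem. With equality weakened to an inequality it characterises nonpositive
  curvature, and it is the only trace of the comparison plane in what follows.
\<close>

lemma dist_segment_point_sq:
  fixes p q r :: "'v::real_inner"
  shows "(dist (p + t *\<^sub>R (q - p)) r)\<^sup>2
    = (1-t) * (dist p r)\<^sup>2 + t * (dist q r)\<^sup>2 - t*(1-t) * (dist p q)\<^sup>2"
  unfolding dist_norm power2_norm_eq_inner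
  by (simp add: inner_diff_left inner_diff_right inner_add_left inner_add_right inner_commute algebra_simps)

locale CAT0 = Metric_space M d for M :: "'a set" and d +
  assumes CAT0: "CAT0_space M d"
begin

lemma between_exists:
  assumes "p \<in> M" "q \<in> M" "0 \<le> t" "t \<le> 1"
  obtains m where "m \<in> M" "d p m = t * d p q" "d m q = (1-t) * d p q"
    "\<And>z. z \<in> M \<Longrightarrow> (d z m)\<^sup>2 \<le> (1-t) * (d z p)\<^sup>2 + t * (d z q)\<^sup>2 - t*(1-t) * (d p q)\<^sup>2"
proof -
  let ?D = "d p q"
  obtain c where c: "geodesic_from_to M d p q c"
    using CAT0 assms unfolding CAT0_space_def geodesic_space_def by meson
  define m where "m = c (t * ?D)"
  have tD: "t * ?D \<in> {0..?D}"
    using assms by (auto intro: mult_left_le_one_le)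
  have c0: "c 0 = p" "c ?D = q" and ciso: "\<And>s t. s \<in> {0..?D} \<Longrightarrow> t \<in> {0..?D} \<Longrightarrow> d (c s) (c t) = \<bar>s-t\<bar>"
    using c by (auto simp: geodesic_from_to_def)
  have mM: "m \<in> M" using c tD unfolding geodesic_from_to_def m_def by blast
  have m1: "d p m = t * ?D" using ciso[of 0 "t * ?D"] c0 tD by (simp add: m_def)
  have m2: "d m q = (1-t) * ?D"
    using ciso[of "t * ?D" ?D] c0 tD by (simp add: m_def algebra_simps)
  have "(d z m)\<^sup>2 \<le> (1-t) * (d z p)\<^sup>2 + t * (d z q)\<^sup>2 - t*(1-t) * ?D\<^sup>2" if z: "z \<in> M" for z
  proof -
    obtain c' where c': "geodesic_from_to M d p z c'"
      using CAT0 assms z unfolding CAT0_space_def geodesic_space_def by meson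
    have "?D \<le> d p z + d q z" "d p z \<le> ?D + d q z" "d q z \<le> ?D + d p z"
      using triangle[of p z q] triangle[of p q z] triangle[of q p z] commute[of z q] commute[of q p] assms z by auto
    then obtain p' q' r' :: "real^2" where
      tri: "dist p' q' = ?D" "dist q' r' = d q z" "dist p' r' = d p z"
      using comparison_triangle_exists[of ?D "d p z" "d q z"] nonneg by blast
    define x' where "x' = p' + t *\<^sub>R (q' - p')"
    have "x' \<in> closed_segment p' q'"
      using assms by (auto simp: x'_def closed_segment_def algebra_simps intro!: exI[of _ t])
    moreover have "dist p' x' = t * ?D"
      using assms tri by (simp add: x'_def dist_norm norm_minus_commute)
    moreover have "r' \<in> closed_segment p' r'" by simp
    moreover have "d p z \<in> {0..d p z}" by simp
    ultimately have "d (c (t * ?D)) (c' (d p z)) \<le> dist x' r'"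
      using CAT0 c c' assms z tri tD unfolding CAT0_space_def by blast
    moreover have "c' (d p z) = z" using c' by (simp add: geodesic_from_to_def)
    ultimately have "d z m \<le> dist x' r'" by (simp add: m_def commute)
    then have "(d z m)\<^sup>2 \<le> (dist x' r')\<^sup>2" by (intro power_mono) auto
    also have "\<dots> = (1-t) * (d z p)\<^sup>2 + t * (d z q)\<^sup>2 - t*(1-t) * ?D\<^sup>2"
      unfolding x'_def dist_segment_point_sq tri by (simp add: commute)
    finally show ?thesis .
  qed
  then show ?thesis using that mM m1 m2 by blast
qed

text \<open>
  Applied to a point \<open>m\<close> that divides \<open>p\<close>, \<open>q\<close> in the same ratio as the point of a geodesic, the
  comparison inequality gives distance zero between the two. So points between \<open>p\<close> and \<open>q\<close> are
  determined by the ratio, and the inequality holds for all of them without reference to a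
  geodesic.
\<close>

lemma CN_inequality:
  assumes "p \<in> M" "q \<in> M" "m \<in> M" "z \<in> M" "0 \<le> t" "t \<le> 1"
    and m: "d p m = t * d p q" "d m q = (1-t) * d p q"
  shows "(d z m)\<^sup>2 \<le> (1-t) * (d z p)\<^sup>2 + t * (d z q)\<^sup>2 - t*(1-t) * (d p q)\<^sup>2"
proof -
  obtain m' where m': "m' \<in> M"
    "\<And>z. z \<in> M \<Longrightarrow> (d z m')\<^sup>2 \<le> (1-t) * (d z p)\<^sup>2 + t * (d z q)\<^sup>2 - t*(1-t) * (d p q)\<^sup>2"
    using between_exists assms by metis
  have "(d m m')\<^sup>2 \<le> (1-t) * (t * d p q)\<^sup>2 + t * ((1-t) * d p q)\<^sup>2 - t*(1-t) * (d p q)\<^sup>2"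
    using m'(2)[of m] assms m by (simp add: commute)
  also have "\<dots> = 0" by (simp add: power2_eq_square algebra_simps)
  finally have "m = m'" using assms m' by simp
  then show ?thesis using m' assms by simp
qed

text \<open>
  Compare the ends of one diagonal with the midpoint of the other. Equality would be the
  parallelogram law; for quadrilaterals that stand on a flat, the upper bound on the diagonals makes
  the projection to the flat nonexpanding and rectangles Euclidean.
\<close>

lemma quadrilateral_inequality:
  assumes "x \<in> M" "y \<in> M" "z \<in> M" "w \<in> M"
  shows "(d x z)\<^sup>2 + (d y w)\<^sup>2 \<le> (d x y)\<^sup>2 + (d y z)\<^sup>2 + (d z w)\<^sup>2 + (d w x)\<^sup>2"
proof -
  obtain m where m: "m \<in> M"
    "\<And>u. u \<in> M \<Longrightarrow> (d u m)\<^sup>2 \<le> (1-1/2) * (d u x)\<^sup>2 + 1/2 * (d u z)\<^sup>2 - 1/2*(1-1/2) * (d x z)\<^sup>2"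
  proof (rule between_exists[OF assms(1,3), of "1/2"])
  qed (auto intro!: that simp del: divide_le_eq_numeral1 le_divide_eq_numeral1)
  have "d y w \<le> d y m + d w m" using triangle' assms m commute by metis
  then have "(d y w)\<^sup>2 \<le> (d y m + d w m)\<^sup>2" by (intro power_mono) auto
  also have "\<dots> \<le> 2 * (d y m)\<^sup>2 + 2 * (d w m)\<^sup>2"
    using sum_squares_ge_zero[of "d y m - d w m" 0] by (simp add: power2_eq_square algebra_simps)
  finally have "(d y w)\<^sup>2 \<le> 2 * (d y m)\<^sup>2 + 2 * (d w m)\<^sup>2" .
  moreover have "(d y m)\<^sup>2 \<le> 1/2 * (d x y)\<^sup>2 + 1/2 * (d y z)\<^sup>2 - 1/4 * (d x z)\<^sup>2"
    using m(2)[OF assms(2)] unfolding commute[of y x] by simp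
  moreover have "(d w m)\<^sup>2 \<le> 1/2 * (d w x)\<^sup>2 + 1/2 * (d z w)\<^sup>2 - 1/4 * (d x z)\<^sup>2"
    using m(2)[OF assms(4)] unfolding commute[of w z] by simp
  ultimately show ?thesis by linarith
qed

lemma between_same_vertex:
  assumes "p \<in> M" "q \<in> M" "r \<in> M" "x \<in> M" "y \<in> M" "0 \<le> t" "t \<le> 1"
    and x: "d p x = t * d p q" "d x q = (1-t) * d p q"
    and y: "d p y = t * d p r" "d y r = (1-t) * d p r"
  shows "d x y \<le> t * d q r"
proof -
  have "(d x y)\<^sup>2 \<le> (1-t) * (d x p)\<^sup>2 + t * (d x r)\<^sup>2 - t*(1-t) * (d p r)\<^sup>2"
    using CN_inequality[of p r y x t] assms by simp
  moreover have "(d r x)\<^sup>2 \<le> (1-t) * (d r p)\<^sup>2 + t * (d r q)\<^sup>2 - t*(1-t) * (d p q)\<^sup>2"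
    using CN_inequality[of p q x r t] assms by simp
  then have "t * (d x r)\<^sup>2 \<le> t * ((1-t) * (d p r)\<^sup>2 + t * (d q r)\<^sup>2 - t*(1-t) * (d p q)\<^sup>2)"
    using \<open>0 \<le> t\<close> by (intro mult_left_mono) (simp_all add: commute)
  ultimately have "(d x y)\<^sup>2 \<le> (1-t) * (t * d p q)\<^sup>2
     + t * ((1-t) * (d p r)\<^sup>2 + t * (d q r)\<^sup>2 - t*(1-t) * (d p q)\<^sup>2) - t*(1-t) * (d p r)\<^sup>2"
    using x by (simp add: commute)
  also have "\<dots> = (t * d q r)\<^sup>2" by (simp add: power2_eq_square algebra_simps)
  finally show ?thesis using \<open>0 \<le> t\<close> by (meson nonneg mult_nonneg_nonneg power2_le_imp_le)
qed

lemma convex_metric: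
  assumes "p \<in> M" "q \<in> M" "p' \<in> M" "q' \<in> M" "x \<in> M" "y \<in> M" "0 \<le> t" "t \<le> 1"
    and x: "d p x = t * d p q" "d x q = (1-t) * d p q"
    and y: "d p' y = t * d p' q'" "d y q' = (1-t) * d p' q'"
  shows "d x y \<le> (1-t) * d p p' + t * d q q'"
proof -
  obtain m where m: "m \<in> M" "d p m = t * d p q'" "d m q' = (1-t) * d p q'"
    using between_exists assms by metis
  have "d x m \<le> t * d q q'" using between_same_vertex[of p q q' x m t] assms m by simp
  moreover have "d m y \<le> (1-t) * d p p'"
    using between_same_vertex[of q' p p' m y "1-t"] assms m by (simp add: commute)
  ultimately show ?thesis using triangle[of x m y] assms m by simp
qed

end

text \<open>
  Divide by \<open>t\<close> and let \<open>t\<close> tend to zero. In a CAT(0) space the squared distance to a point is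
  strongly convex along geodesics, and this is how it is seen to grow quadratically away from a
  minimum.
\<close>

lemma strong_convexity_limit:
  fixes A B D :: real
  assumes "\<And>t. 0 < t \<Longrightarrow> t < 1 \<Longrightarrow> A \<le> (1-t) * A + t * B - t*(1-t) * D"
  shows "A + D \<le> B"
proof (rule field_le_epsilon)
  have *: "A + (1-t) * D \<le> B" if "0 < t" "t < 1" for t
  proof -
    have "t * (A + (1-t) * D) \<le> t * B" using assms[OF that] by (simp add: algebra_simps)
    then show ?thesis using that by simp
  qed
  fix e :: real assume "e > 0"
  define t where "t = min (1/2) (e / (\<bar>D\<bar> + 1))"
  have t: "0 < t" "t < 1" "t * (\<bar>D\<bar> + 1) \<le> e"
    using \<open>e>0\<close> by (auto simp: t_def min_def pos_le_divide_eq)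
  have "t * D \<le> t * (\<bar>D\<bar> + 1)" using t by (intro mult_left_mono) auto
  then show "A + D \<le> B + e" using *[OF t(1,2)] t(3) by (simp add: algebra_simps)
qed

section \<open>Properness\<close>

context CAT0
begin

lemma point_in_smaller_ball:
  assumes "x \<in> M" "a \<in> M" "d a x \<le> R + e" "0 \<le> R" "0 \<le> e"
  obtains y where "y \<in> M" "d a y \<le> R" "d y x \<le> e"
proof (cases "d a x \<le> R")
  case True then show ?thesis using that[of x] assms by simp
next
  case False
  then have pos: "d a x > 0" using assms by linarith
  define t where "t = R / d a x"
  obtain y where "y \<in> M" "d a y = t * d a x" "d y x = (1-t) * d a x"
  proof (rule between_exists[OF assms(2,1)])
    show "0 \<le> t" "t \<le> 1" using assms False pos by (auto simp: t_def)
  qed (use that in blast)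
  moreover have "t * d a x = R" using pos by (simp add: t_def)
  moreover have "(1-t) * d a x = d a x - R" using pos by (simp add: t_def field_simps)
  ultimately show ?thesis using that[of y] assms by auto
qed

lemma finite_net:
  assumes "compactin mtopology K" "0 < e"
  obtains N where "finite N" "N \<subseteq> K" "K \<subseteq> (\<Union>x\<in>N. mball x e)"
proof -
  have "mtotally_bounded K" using assms compactin_imp_mtotally_bounded by blast
  then have "\<exists>N. finite N \<and> N \<subseteq> K \<and> K \<subseteq> (\<Union>x\<in>N. mball x e)"
    using \<open>0 < e\<close> by (simp add: mtotally_bounded_def)
  then show ?thesis using that by blast
qed

text \<open>
  The Hopf--Rinow theorem: the set of radii whose closed balls are compact is closed (such a ball
  is totally bounded, as it lies near slightly smaller ones) and open (a compact ball has a
  compact neighbourhood).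
\<close>

lemma Hopf_Rinow:
  assumes comp: "mcomplete" and lc: "locally_compact_space mtopology"
  shows "compactin mtopology (mcball a R)"
proof (cases "a \<in> M \<and> 0 \<le> R")
  case False
  then have "mcball a R = {}" using mcball_eq_empty by (meson not_less)
  then show ?thesis by simp
next
  case True
  define P where "P R \<longleftrightarrow> compactin mtopology (mcball a R)" for R
  have mono: "P r" if "P s" "r \<le> s" for r s
    using that closed_compactin[of mtopology "mcball a s" "mcball a r"] mcball_subset_concentric
    unfolding P_def by blast
  have P0: "P 0"
  proof -
    have "x = a" if "x \<in> M" "d a x \<le> 0" for x
      using that True nonneg[of a x] zero[of a x] by auto
    then have "mcball a 0 = {a}" using True by auto
    then show ?thesis unfolding P_def using True by simp
  qed
  have opn: "\<exists>e>0. P (s + e)" if "P s" "0 \<le> s" for s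
  proof -
    have "\<exists>U K. openin mtopology U \<and> compactin mtopology K \<and> x \<in> U \<and> U \<subseteq> K" if "x \<in> M" for x
      using lc that unfolding locally_compact_space_def by auto
    then obtain U K where UK: "\<And>x. x \<in> M \<Longrightarrow>
        openin mtopology (U x) \<and> compactin mtopology (K x) \<and> x \<in> U x \<and> U x \<subseteq> K x" by metis
    note s0 = \<open>0 \<le> s\<close>
    have c: "compactin mtopology (mcball a s)" using that P_def by simp
    obtain e where e: "e > 0" "\<And>x. x \<in> mcball a s \<Longrightarrow> \<exists>V\<in>U ` mcball a s. mball x e \<subseteq> V"
    proof -
      have "mcball a s \<subseteq> \<Union>(U ` mcball a s)" using UK mcball_subset_mspace by blast
      moreover have "openin mtopology V" if "V \<in> U ` mcball a s" for V
        using UK that mcball_subset_mspace by blast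
      ultimately show thesis using lebesgue_number[OF c, of "U ` mcball a s"] that by metis
    qed
    obtain N where N: "finite N" "N \<subseteq> mcball a s" "mcball a s \<subseteq> (\<Union>x\<in>N. mball x (e/2))"
      using finite_net[OF c, of "e/2"] e(1) by auto
    have "\<exists>C. compactin mtopology C \<and> mball x e \<subseteq> C" if "x \<in> mcball a s" for x
      using e(2)[OF that] UK by (metis image_iff in_mcball subset_trans)
    then obtain C where C: "\<And>x. x \<in> mcball a s \<Longrightarrow> compactin mtopology (C x) \<and> mball x e \<subseteq> C x" by metis
    have "mcball a (s + e/4) \<subseteq> (\<Union>x\<in>N. C x)"
    proof
      fix x assume x: "x \<in> mcball a (s + e/4)"
      then obtain y where y: "y \<in> M" "d a y \<le> s" "d y x \<le> e/4"
        using point_in_smaller_ball[of x a s "e/4"] s0 e(1) by auto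
      then obtain n where n: "n \<in> N" "y \<in> mball n (e/2)" using N(3) True by (auto simp: subset_iff)
      then have "d n x < e" using triangle[of n y x] x y e(1) by auto
      then have "x \<in> mball n e" using n x by auto
      then show "x \<in> (\<Union>x\<in>N. C x)" using C n N(2) by blast
    qed
    moreover have "compactin mtopology (\<Union>x\<in>N. C x)"
      using N C by (intro compactin_Union) auto
    ultimately have "P (s + e/4)" unfolding P_def
      using closed_compactin[OF _ _ closedin_mcball] by blast
    then show ?thesis using e(1) by (intro exI[of _ "e/4"]) auto
  qed
  have cls: "P s" if s: "0 < s" and *: "\<And>r. 0 \<le> r \<Longrightarrow> r < s \<Longrightarrow> P r" for s
  proof -
    have "mtotally_bounded (mcball a s)"
      unfolding mtotally_bounded_def
    proof (intro allI impI)
      fix e :: real assume e: "e > 0"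
      define h where "h = min (e/2) (s/2)"
      have h: "0 < h" "h \<le> e/2" "h < s" using e s by (auto simp: h_def)
      have "compactin mtopology (mcball a (s - h))" using *[of "s-h"] h unfolding P_def by simp
      then obtain N where N: "finite N" "N \<subseteq> mcball a (s-h)" "mcball a (s-h) \<subseteq> (\<Union>x\<in>N. mball x (e/2))"
        using finite_net[of _ "e/2"] e by (metis half_gt_zero)
      have "mcball a s \<subseteq> (\<Union>x\<in>N. mball x e)"
      proof
        fix x assume x: "x \<in> mcball a s"
        then obtain y where y: "y \<in> M" "d a y \<le> s-h" "d y x \<le> h"
          using point_in_smaller_ball[of x a "s-h" h] h by auto
        then obtain n where n: "n \<in> N" "y \<in> mball n (e/2)" using N(3) True by (auto simp: subset_iff)
        then have "d n x < e" using triangle[of n y x] x y h by auto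
        then show "x \<in> (\<Union>x\<in>N. mball x e)" using n x by auto
      qed
      moreover have "N \<subseteq> mcball a s"
        using N(2) h mcball_subset_concentric[of "s-h" s a] by auto
      ultimately show "\<exists>K. finite K \<and> K \<subseteq> mcball a s \<and> mcball a s \<subseteq> (\<Union>x\<in>K. mball x e)"
        using N(1) by blast
    qed
    then have "compactin mtopology (mtopology closure_of mcball a s)"
      using mtotally_bounded_eq_compact_closure_of[OF comp] by simp
    then show ?thesis unfolding P_def by (simp add: closure_of_closedin)
  qed
  show ?thesis
  proof (rule ccontr)
    assume n: "\<not> ?thesis"
    define S where "S = {r. 0 \<le> r \<and> P r}"
    have bdd: "r < R" if "r \<in> S" for r
    proof (rule ccontr)
      assume "\<not> r < R"
      then have "P R" using that mono[of r R] by (simp add: S_def)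
      then show False using n by (simp add: P_def)
    qed
    have 0: "0 \<in> S" using P0 S_def by simp
    have bddS: "bdd_above S" by (rule bdd_aboveI[of _ R]) (use bdd in fastforce)
    define s where "s = Sup S"
    obtain e where e: "e > 0" "P (0+e)" using opn[OF P0] by auto
    then have "e \<le> s" unfolding s_def using bddS S_def by (intro cSup_upper) auto
    have "P r" if "0 \<le> r" "r < s" for r
    proof -
      obtain r' where "r' \<in> S" "r < r'" using \<open>r < s\<close> less_cSupD[of S r] 0 unfolding s_def by blast
      then show ?thesis using mono[of r' r] by (simp add: S_def)
    qed
    then have "P s" using cls[of s] e \<open>e \<le> s\<close> by auto
    then obtain e' where "e' > 0" "P (s + e')" using opn[of s] e \<open>e \<le> s\<close> by auto
    then have "s + e' \<le> s" unfolding s_def using bddS e \<open>e \<le> s\<close>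
      by (intro cSup_upper) (auto simp: S_def s_def)
    then show False using \<open>e' > 0\<close> by simp
  qed
qed

end

section \<open>Barycentres\<close>

locale proper_CAT0 = CAT0 +
  assumes proper: "\<And>a R. compactin mtopology (mcball a R)"
begin

text \<open>
  The weighted sum of squared distances to the points \<open>z i\<close> is minimal at \<open>m\<close>. The additional
  summand \<open>(d m y)\<^sup>2\<close> is the quadratic growth that strong convexity gives at a minimum; it makes
  the minimum unique and stable, and all that follows about barycentres comes from it.
\<close>

definition barycentre :: "'i set \<Rightarrow> ('i \<Rightarrow> 'a) \<Rightarrow> ('i \<Rightarrow> real) \<Rightarrow> 'a \<Rightarrow> bool"
  where "barycentre I z w m \<longleftrightarrow> m \<in> M \<and>
    (\<forall>y\<in>M. (\<Sum>i\<in>I. w i * (d m (z i))\<^sup>2) + (d m y)\<^sup>2 \<le> (\<Sum>i\<in>I. w i * (d y (z i))\<^sup>2))"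

lemma barycentre_exists:
  assumes I: "finite I" and z: "\<And>i. i \<in> I \<Longrightarrow> z i \<in> M"
    and w: "\<And>i. i \<in> I \<Longrightarrow> 0 \<le> w i" and sum1: "sum w I = 1"
  shows "\<exists>m. barycentre I z w m"
proof -
  define \<Phi> where "\<Phi> y = (\<Sum>i\<in>I. w i * (d y (z i))\<^sup>2)" for y
  obtain i0 where i0: "i0 \<in> I" using sum1 by fastforce
  define a where "a = z i0"
  have aM: "a \<in> M" using i0 z a_def by simp
  define K where "K = Max ((\<lambda>i. d a (z i)) ` I)"
  have K: "d a (z i) \<le> K" if "i \<in> I" for i
    using I that by (simp add: K_def)
  have K0: "0 \<le> K" using K[OF i0] nonneg by (meson order_trans)
  let ?B = "mcball a (2*K)"
  have "continuous_map mtopology euclideanreal (\<lambda>y. d y x)" if "x \<in> M" for x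
    using continuous_on_mdist[of x "metric (M,d)"] that by (simp add: commute[of _ x])
  then have "continuous_map mtopology euclideanreal \<Phi>"
    unfolding \<Phi>_def using I z by (intro continuous_intros) auto
  then have "compact (\<Phi> ` ?B)" using image_compactin[OF proper[of a "2*K"]] by fastforce
  moreover have "a \<in> ?B" using aM K0 by simp
  ultimately obtain m where m: "m \<in> ?B" "\<And>y. y \<in> ?B \<Longrightarrow> \<Phi> m \<le> \<Phi> y"
    using compact_attains_inf[of "\<Phi> ` ?B"] by blast
  have min: "\<Phi> m \<le> \<Phi> y" if y: "y \<in> M" for y
  proof (cases "y \<in> ?B")
    case False
    have "\<Phi> a \<le> \<Phi> y" unfolding \<Phi>_def
    proof (intro sum_mono mult_left_mono power_mono)
      fix i assume i: "i \<in> I"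
      have "d a y \<le> d a (z i) + d y (z i)" using triangle' aM y z[OF i] by simp
      then show "d a (z i) \<le> d y (z i)" using False aM y K[OF i] by simp
    qed (use w in auto)
    then show ?thesis using m(2)[OF \<open>a \<in> ?B\<close>] by simp
  qed (use m in auto)
  have mM: "m \<in> M" using m by simp
  have "\<Phi> m + (d m y)\<^sup>2 \<le> \<Phi> y" if y: "y \<in> M" for y
  proof (rule strong_convexity_limit)
    fix t :: real assume t: "0 < t" "t < 1"
    obtain x where x: "x \<in> M"
      "\<And>z. z \<in> M \<Longrightarrow> (d z x)\<^sup>2 \<le> (1-t) * (d z m)\<^sup>2 + t * (d z y)\<^sup>2 - t*(1-t) * (d m y)\<^sup>2"
      using between_exists[of m y t] mM y t by (metis less_imp_le)
    have "\<Phi> m \<le> \<Phi> x" using min x by simp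
    also have "\<dots> \<le> (\<Sum>i\<in>I. w i * ((1-t) * (d m (z i))\<^sup>2 + t * (d y (z i))\<^sup>2 - t*(1-t) * (d m y)\<^sup>2))"
      unfolding \<Phi>_def
      by (intro sum_mono mult_left_mono) (use x(2)[OF z] w in \<open>auto simp: commute\<close>)
    also have "\<dots> = (\<Sum>i\<in>I. (1-t) * (w i * (d m (z i))\<^sup>2) + t * (w i * (d y (z i))\<^sup>2)
         - t*(1-t) * (d m y)\<^sup>2 * w i)"
      by (intro sum.cong) (simp_all add: algebra_simps)
    also have "\<dots> = (1-t) * \<Phi> m + t * \<Phi> y - t*(1-t) * (d m y)\<^sup>2"
      unfolding \<Phi>_def sum.distrib sum_subtractf sum_distrib_left[symmetric] sum1 by simp
    finally show "\<Phi> m \<le> (1-t) * \<Phi> m + t * \<Phi> y - t*(1-t) * (d m y)\<^sup>2" .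
  qed
  then show ?thesis unfolding barycentre_def \<Phi>_def using mM by blast
qed

lemma barycentre_near:
  assumes m: "barycentre I z w m" and w: "\<And>i. i \<in> I \<Longrightarrow> 0 \<le> w i" "sum w I = 1"
    and p: "p \<in> M" and near: "\<And>i. i \<in> I \<Longrightarrow> 0 < w i \<Longrightarrow> d p (z i) \<le> e" and "0 \<le> e"
  shows "d m p \<le> e"
proof -
  have "0 \<le> (\<Sum>i\<in>I. w i * (d m (z i))\<^sup>2)" using w by (intro sum_nonneg) auto
  moreover have "(\<Sum>i\<in>I. w i * (d m (z i))\<^sup>2) + (d m p)\<^sup>2 \<le> (\<Sum>i\<in>I. w i * (d p (z i))\<^sup>2)"
    using m p unfolding barycentre_def by blast
  moreover have "(\<Sum>i\<in>I. w i * (d p (z i))\<^sup>2) \<le> (\<Sum>i\<in>I. w i * e\<^sup>2)"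
  proof (intro sum_mono)
    fix i assume i: "i \<in> I"
    show "w i * (d p (z i))\<^sup>2 \<le> w i * e\<^sup>2"
    proof (cases "w i = 0")
      case False
      then have "0 < w i" using w(1)[OF i] by simp
      then show ?thesis using near[OF i] by (intro mult_left_mono power_mono) auto
    qed simp
  qed
  moreover have "(\<Sum>i\<in>I. w i * e\<^sup>2) = e\<^sup>2" using w(2) by (simp flip: sum_distrib_right)
  ultimately have "(d m p)\<^sup>2 \<le> e\<^sup>2" by linarith
  then show ?thesis using \<open>0 \<le> e\<close> power2_le_imp_le by blast
qed

text \<open>
  Adding the two variance inequalities, each tested at the other barycentre, bounds the square of
  the displacement by the change of weights times the displacement itself.
\<close>

lemma barycentre_Lipschitz:
  assumes m: "barycentre I z w m" and m': "barycentre I z w' m'"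
    and I: "finite I" and z: "\<And>i. i \<in> I \<Longrightarrow> z i \<in> M"
    and w: "\<And>i. i \<in> I \<Longrightarrow> 0 \<le> w i" "sum w I = 1"
    and w': "\<And>i. i \<in> I \<Longrightarrow> 0 \<le> w' i" "sum w' I = 1"
    and K: "\<And>i j. i \<in> I \<Longrightarrow> j \<in> I \<Longrightarrow> d (z i) (z j) \<le> K" and "0 \<le> K"
  shows "d m m' \<le> K * (\<Sum>i\<in>I. \<bar>w i - w' i\<bar>)"
proof -
  define S where "S = (\<Sum>i\<in>I. \<bar>w i - w' i\<bar>)"
  let ?D = "d m m'"
  have M: "m \<in> M" "m' \<in> M" using m m' by (auto simp: barycentre_def)
  have near: "d m (z i) \<le> K" "d m' (z i) \<le> K" if "i \<in> I" for i
    using barycentre_near[OF m w z[OF that] K[OF that] \<open>0 \<le> K\<close>]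
      barycentre_near[OF m' w' z[OF that] K[OF that] \<open>0 \<le> K\<close>] by auto
  have "(\<Sum>i\<in>I. w i * (d m (z i))\<^sup>2) + ?D\<^sup>2 \<le> (\<Sum>i\<in>I. w i * (d m' (z i))\<^sup>2)"
    using m M unfolding barycentre_def by blast
  moreover have "(\<Sum>i\<in>I. w' i * (d m' (z i))\<^sup>2) + ?D\<^sup>2 \<le> (\<Sum>i\<in>I. w' i * (d m (z i))\<^sup>2)"
    using m' M commute[of m' m] unfolding barycentre_def by metis
  moreover have "(\<Sum>i\<in>I. (w i - w' i) * ((d m' (z i))\<^sup>2 - (d m (z i))\<^sup>2))
      = ((\<Sum>i\<in>I. w i * (d m' (z i))\<^sup>2) - (\<Sum>i\<in>I. w i * (d m (z i))\<^sup>2))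
        - ((\<Sum>i\<in>I. w' i * (d m' (z i))\<^sup>2) - (\<Sum>i\<in>I. w' i * (d m (z i))\<^sup>2))"
    by (simp only: left_diff_distrib right_diff_distrib sum_subtractf)
  ultimately have "2 * ?D\<^sup>2 \<le> (\<Sum>i\<in>I. (w i - w' i) * ((d m' (z i))\<^sup>2 - (d m (z i))\<^sup>2))"
    by linarith
  also have "\<dots> \<le> (\<Sum>i\<in>I. \<bar>w i - w' i\<bar> * (?D * (2*K)))"
  proof (intro sum_mono)
    fix i assume i: "i \<in> I"
    have "\<bar>d m' (z i) - d m (z i)\<bar> \<le> ?D"
      using triangle[of m m' "z i"] triangle[of m' m "z i"] M z[OF i] commute[of m m'] by (simp add: abs_le_iff)
    moreover have "\<bar>d m' (z i) + d m (z i)\<bar> \<le> 2*K" using near[OF i] by simp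
    ultimately have "\<bar>(d m' (z i))\<^sup>2 - (d m (z i))\<^sup>2\<bar> \<le> ?D * (2*K)"
      unfolding power2_eq_square square_diff_square_factored abs_mult
      by (subst mult.commute) (intro mult_mono, auto)
    then have "\<bar>w i - w' i\<bar> * \<bar>(d m' (z i))\<^sup>2 - (d m (z i))\<^sup>2\<bar> \<le> \<bar>w i - w' i\<bar> * (?D * (2*K))"
      by (intro mult_left_mono) auto
    then show "(w i - w' i) * ((d m' (z i))\<^sup>2 - (d m (z i))\<^sup>2) \<le> \<bar>w i - w' i\<bar> * (?D * (2*K))"
      using abs_ge_self[of "(w i - w' i) * ((d m' (z i))\<^sup>2 - (d m (z i))\<^sup>2)"]
      unfolding abs_mult by linarith
  qed
  also have "\<dots> = S * (?D * (2*K))" unfolding S_def by (simp only: sum_distrib_right)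
  finally have *: "?D * ?D \<le> ?D * (K * S)" by (simp add: power2_eq_square mult_ac)
  have "S \<ge> 0" unfolding S_def by (intro sum_nonneg) auto
  then have "?D \<le> K * S"
  proof (cases "?D = 0")
    case True
    then show ?thesis using \<open>0 \<le> K\<close> \<open>S \<ge> 0\<close> by simp
  next
    case False
    then have "0 < ?D" using nonneg[of m m'] by linarith
    then show ?thesis using * mult_le_cancel_left_pos by blast
  qed
  then show ?thesis by (simp only: S_def)
qed

text \<open>
  In a CAT(0) space a map given on a finite net extends continuously without losing control of the
  size of its image: take barycentres for a partition of unity. This replaces filling in the
  simplices of a triangulation.
\<close>

lemma continuous_interpolation:
  fixes N U :: "'e::metric_space set"
  assumes N: "finite N" and z: "\<And>n. n \<in> N \<Longrightarrow> z n \<in> M" and "0 < \<delta>"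
    and cover: "\<And>u. u \<in> U \<Longrightarrow> \<exists>n\<in>N. dist u n < \<delta>"
  shows "\<exists>F. (\<forall>u\<in>U. F u \<in> M) \<and>
     (\<forall>u\<in>U. \<forall>p\<in>M. \<forall>e\<ge>0. (\<forall>n\<in>N. dist u n < \<delta> \<longrightarrow> d p (z n) \<le> e) \<longrightarrow> d (F u) p \<le> e) \<and>
     (\<forall>u\<in>U. ((\<lambda>v. d (F u) (F v)) \<longlongrightarrow> 0) (at u within U))"
proof -
  \<comment> \<open>tent functions, whose normalisation \<open>w\<close> is the partition of unity\<close>
  define q where "q n u = max 0 (\<delta> - dist u n)" for n u :: 'e
  define S where "S u = (\<Sum>n\<in>N. q n u)" for u
  define w where "w u n = q n u / S u" for u n
  have S: "S u > 0" if u: "u \<in> U" for u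
  proof -
    obtain n where "n \<in> N" "dist u n < \<delta>" using cover u by blast
    then show ?thesis unfolding S_def q_def using N by (intro sum_pos2[of N n]) auto
  qed
  have w0: "0 \<le> w u n" if "u \<in> U" for u n
    using S[OF that] by (simp add: w_def q_def)
  have w1: "sum (w u) N = 1" if "u \<in> U" for u
    using S[OF that] by (simp add: w_def S_def flip: sum_divide_distrib)
  have "\<forall>u\<in>U. \<exists>m. barycentre N z (w u) m"
    by (intro ballI barycentre_exists N z w0 w1)
  then obtain F where F: "\<And>u. u \<in> U \<Longrightarrow> barycentre N z (w u) (F u)" by metis
  show ?thesis
  proof (intro exI conjI ballI allI impI)
    show "F u \<in> M" if "u \<in> U" for u using F[OF that] by (simp add: barycentre_def)
    show "d (F u) p \<le> e" if u: "u \<in> U" and "p \<in> M" "0 \<le> e"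
      and near: "\<forall>n\<in>N. dist u n < \<delta> \<longrightarrow> d p (z n) \<le> e" for u p e
    proof (rule barycentre_near[OF F[OF u] w0[OF u] w1[OF u] \<open>p \<in> M\<close> _ \<open>0 \<le> e\<close>])
      fix n assume "n \<in> N" "0 < w u n"
      then have "dist u n < \<delta>" using S[OF u] by (auto simp: w_def q_def zero_less_divide_iff max_def split: if_splits)
      then show "d p (z n) \<le> e" using near \<open>n \<in> N\<close> by blast
    qed
    fix u assume u: "u \<in> U"
    \<comment> \<open>the Lipschitz constant of \<open>barycentre_Lipschitz\<close>\<close>
    define K where "K = Max (insert 0 ((\<lambda>(i,j). d (z i) (z j)) ` (N \<times> N)))"
    have K0: "0 \<le> K" unfolding K_def using N by (intro Max_ge) auto
    have K: "d (z i) (z j) \<le> K" if "i \<in> N" "j \<in> N" for i j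
      unfolding K_def using N that by (intro Max_ge) auto
    have cq: "continuous_on UNIV (q n)" for n
      unfolding q_def by (intro continuous_intros)
    have q: "((q n) \<longlongrightarrow> q n u) (at u within U)" for n
      using cq[of n] by (meson continuous_on_def continuous_on_subset subset_UNIV u)
    have "((\<lambda>v. K * (\<Sum>n\<in>N. \<bar>w u n - w v n\<bar>)) \<longlongrightarrow> K * (\<Sum>n\<in>N. \<bar>w u n - w u n\<bar>)) (at u within U)"
      unfolding w_def S_def
      by (intro tendsto_intros q) (use S[OF u] in \<open>auto simp: S_def\<close>)
    then have lim: "((\<lambda>v. K * (\<Sum>n\<in>N. \<bar>w u n - w v n\<bar>)) \<longlongrightarrow> 0) (at u within U)" by simp
    have "\<forall>\<^sub>F v in at u within U. v \<in> U" by (simp add: eventually_at_filter)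
    then have ev: "\<forall>\<^sub>F v in at u within U. d (F u) (F v) \<le> K * (\<Sum>n\<in>N. \<bar>w u n - w v n\<bar>)"
    proof eventually_elim
      case (elim v)
      show ?case
        by (rule barycentre_Lipschitz[OF F[OF u] F[OF elim] N z w0[OF u] w1[OF u] w0[OF elim] w1[OF elim] K K0])
    qed
    show "((\<lambda>v. d (F u) (F v)) \<longlongrightarrow> 0) (at u within U)"
      by (rule tendsto_sandwich[OF _ ev tendsto_const lim]) auto
  qed
qed

end

section \<open>The nearest point projection onto a flat\<close>

locale flat = CAT0 M d for M :: "'a set" and d +
  fixes \<phi> :: "'v::euclidean_space \<Rightarrow> 'a"
  assumes flat: "isometric_embedding UNIV M d \<phi>"
begin

lemma flat_in [simp]: "\<phi> v \<in> M" and flat_dist [simp]: "d (\<phi> v) (\<phi> w) = dist v w"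
  using flat by (auto simp: isometric_embedding_def)

text \<open>
  The nearest point of the flat, specified by the obtuse angle that \<open>nearest_imp_obtuse\<close> finds there;
  by this inequality it is unique.
\<close>

definition foot :: "'a \<Rightarrow> 'v"
  where "foot y = (SOME p. \<forall>w. (d y (\<phi> p))\<^sup>2 + (dist p w)\<^sup>2 \<le> (d y (\<phi> w))\<^sup>2)"

text \<open>
  The angle at the nearest point is at least a right angle; strong convexity of the squared
  distance expresses this without angles.
\<close>

lemma nearest_imp_obtuse:
  assumes y: "y \<in> M" and min: "\<And>v. d y (\<phi> p) \<le> d y (\<phi> v)"
  shows "(d y (\<phi> p))\<^sup>2 + (dist p w)\<^sup>2 \<le> (d y (\<phi> w))\<^sup>2"
proof (rule strong_convexity_limit)
  fix t :: real assume t: "0 < t" "t < 1"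
  let ?x = "p + t *\<^sub>R (w - p)"
  have "dist p ?x = t * dist p w" using t by (simp add: dist_norm norm_minus_commute)
  moreover have "?x - w = (1-t) *\<^sub>R (p - w)" by (simp add: algebra_simps)
  then have "dist ?x w = (1-t) * dist p w" using t by (simp add: dist_norm)
  ultimately have "(d y (\<phi> ?x))\<^sup>2 \<le> (1-t) * (d y (\<phi> p))\<^sup>2 + t * (d y (\<phi> w))\<^sup>2 - t*(1-t) * (d (\<phi> p) (\<phi> w))\<^sup>2"
    using t y by (intro CN_inequality) auto
  moreover have "(d y (\<phi> p))\<^sup>2 \<le> (d y (\<phi> ?x))\<^sup>2" using min by (intro power_mono) auto
  ultimately show "(d y (\<phi> p))\<^sup>2 \<le> (1-t) * (d y (\<phi> p))\<^sup>2 + t * (d y (\<phi> w))\<^sup>2 - t*(1-t) * (dist p w)\<^sup>2"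
    unfolding flat_dist by linarith
qed

lemma foot_obtuse:
  assumes y: "y \<in> M"
  shows "(d y (\<phi> (foot y)))\<^sup>2 + (dist (foot y) w)\<^sup>2 \<le> (d y (\<phi> w))\<^sup>2"
proof -
  let ?R = "2 * d y (\<phi> 0)"
  have "\<bar>d y (\<phi> v) - d y (\<phi> w)\<bar> \<le> dist v w" for v w
    using triangle[of y "\<phi> v" "\<phi> w"] triangle[of y "\<phi> w" "\<phi> v"] y
    by (simp add: dist_commute abs_le_iff)
  then have "continuous_on A (\<lambda>v. d y (\<phi> v))" for A
    unfolding continuous_on_iff dist_real_def by (meson dist_commute_lessI le_less_trans)
  moreover have "cball (0::'v) ?R \<noteq> {}" using nonneg[of y "\<phi> 0"] by (simp add: not_less)
  ultimately have "\<exists>p\<in>cball 0 ?R. \<forall>v\<in>cball 0 ?R. d y (\<phi> p) \<le> d y (\<phi> v)"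
    by (intro continuous_attains_inf compact_cball)
  then obtain p where p: "p \<in> cball 0 ?R" "\<And>v. v \<in> cball 0 ?R \<Longrightarrow> d y (\<phi> p) \<le> d y (\<phi> v)"
    by blast
  have "d y (\<phi> p) \<le> d y (\<phi> v)" for v
  proof (cases "v \<in> cball 0 ?R")
    case False
    then have "d y (\<phi> 0) \<le> d y (\<phi> v)" using triangle[of "\<phi> 0" y "\<phi> v"] y commute[of y "\<phi> 0"] by simp
    then show ?thesis using p(2)[of 0] nonneg[of y "\<phi> 0"] by simp
  qed (use p in blast)
  then have "\<forall>w. (d y (\<phi> p))\<^sup>2 + (dist p w)\<^sup>2 \<le> (d y (\<phi> w))\<^sup>2"
    using nearest_imp_obtuse[OF y] by blast
  then have "\<forall>w. (d y (\<phi> (foot y)))\<^sup>2 + (dist (foot y) w)\<^sup>2 \<le> (d y (\<phi> w))\<^sup>2"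
    unfolding foot_def by (rule someI)
  then show ?thesis by blast
qed

lemma foot_le: "y \<in> M \<Longrightarrow> d y (\<phi> (foot y)) \<le> d y (\<phi> w)"
  using foot_obtuse[of y w] by (meson le_add_same_cancel1 nonneg order_trans power2_le_imp_le zero_le_power2)

text \<open>
  Both angles at the feet being obtuse, the diagonals of the quadrilateral formed by the two points
  and their feet are long; the quadrilateral inequality turns this into a long upper side.
\<close>

lemma foot_Lipschitz:
  assumes "x \<in> M" "y \<in> M"
  shows "dist (foot x) (foot y) \<le> d x y"
proof -
  let ?p = "foot x" and ?q = "foot y"
  have "(d x (\<phi> ?p))\<^sup>2 + (dist ?p ?q)\<^sup>2 \<le> (d x (\<phi> ?q))\<^sup>2" using foot_obtuse assms by simp
  moreover have "(d y (\<phi> ?q))\<^sup>2 + (dist ?p ?q)\<^sup>2 \<le> (d y (\<phi> ?p))\<^sup>2"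
    using foot_obtuse[of y ?p] assms by (simp add: dist_commute)
  moreover have "(d x (\<phi> ?q))\<^sup>2 + (d y (\<phi> ?p))\<^sup>2 \<le> (d x y)\<^sup>2 + (d y (\<phi> ?q))\<^sup>2 + (dist ?p ?q)\<^sup>2 + (d x (\<phi> ?p))\<^sup>2"
    using quadrilateral_inequality[of x y "\<phi> ?q" "\<phi> ?p"] assms
    by (simp add: dist_commute commute[of "\<phi> ?p" x])
  ultimately have "(dist ?p ?q)\<^sup>2 \<le> (d x y)\<^sup>2" by linarith
  then show ?thesis using power2_le_imp_le nonneg by blast
qed

end

section \<open>Half-flats from distant points\<close>

lemma (in Metric_space) tendsto_mdist:
  assumes x: "limitin mtopology x X F" and y: "limitin mtopology y Y F"
  shows "((\<lambda>n. d (x n) (y n)) \<longlongrightarrow> d X Y) F"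
proof (rule tendstoI)
  fix e :: real assume "e > 0"
  then have "eventually (\<lambda>n. x n \<in> M \<and> d (x n) X < e/2) F" "eventually (\<lambda>n. y n \<in> M \<and> d (y n) Y < e/2) F"
    using x y unfolding limitin_metric by (meson half_gt_zero)+
  then show "eventually (\<lambda>n. dist (d (x n) (y n)) (d X Y) < e) F"
  proof eventually_elim
    case (elim n)
    have M: "X \<in> M" "Y \<in> M" using x y limitin_mspace by auto
    have "d (x n) (y n) \<le> d (x n) X + (d X Y + d (y n) Y)"
      using triangle[of "x n" X "y n"] triangle'[of X Y "y n"] elim M by auto
    moreover have "d X Y \<le> d (x n) X + (d (x n) (y n) + d (y n) Y)"
      using triangle''[of X "x n" Y] triangle[of "x n" "y n" Y] elim M by auto
    ultimately show ?case using elim by (simp add: dist_real_def abs_less_iff)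
  qed
qed

lemma geodesic_from_toD:
  assumes c: "geodesic_from_to M d p q c" and t: "0 \<le> t" "t \<le> d p q"
  shows "c t \<in> M" "c 0 = p" "d p (c t) = t" "d (c t) q = d p q - t"
    "\<And>s. 0 \<le> s \<Longrightarrow> s \<le> d p q \<Longrightarrow> d (c s) (c t) = \<bar>s - t\<bar>"
proof -
  have iso: "\<And>s t. s \<in> {0..d p q} \<Longrightarrow> t \<in> {0..d p q} \<Longrightarrow> d (c s) (c t) = \<bar>s - t\<bar>"
    and ends: "c 0 = p" "c (d p q) = q" and sub: "c ` {0..d p q} \<subseteq> M"
    using c by (auto simp: geodesic_from_to_def)
  show "c t \<in> M" using sub t by auto
  show "c 0 = p" by (rule ends)
  show "d (c s) (c t) = \<bar>s - t\<bar>" if "0 \<le> s" "s \<le> d p q" for s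
    using iso that t by simp
  show "d p (c t) = t" using iso[of 0 t] ends t by simp
  show "d (c t) q = d p q - t" using iso[of t "d p q"] ends t by simp
qed

locale proper_flat = proper_CAT0 M d + flat M d \<phi>
  for M :: "'a set" and d and \<phi> :: "'v::euclidean_space \<Rightarrow> 'a"
begin

text \<open>
  By the triangle inequality, the points of the geodesic from \<open>\<phi> x\<close> to \<open>y\<close> share the foot of \<open>y\<close>.
\<close>

lemma foot_on_perpendicular:
  assumes y: "y \<in> M" "foot y = x" and c: "geodesic_from_to M d (\<phi> x) y c"
    and t: "0 \<le> t" "t \<le> d (\<phi> x) y"
  shows "t\<^sup>2 + (dist x w)\<^sup>2 \<le> (d (c t) (\<phi> w))\<^sup>2"
proof -
  let ?H = "d (\<phi> x) y"
  note cM = geodesic_from_toD(1)[OF c t] and ct = geodesic_from_toD(3,4)[OF c t]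
  have "d (c t) (\<phi> x) \<le> d (c t) (\<phi> v)" for v
  proof -
    have "?H \<le> d y (\<phi> v)" using foot_le[OF y(1), of v] y(2) by (simp add: commute)
    also have "\<dots> \<le> d (c t) y + d (c t) (\<phi> v)" using triangle''[of y "c t" "\<phi> v"] cM y by simp
    finally show ?thesis using ct by (simp add: commute[of "c t" "\<phi> x"])
  qed
  from nearest_imp_obtuse[OF cM this, of w] show ?thesis
    using ct by (simp add: commute[of "c t" "\<phi> x"])
qed

text \<open>
  Two perpendiculars to the flat whose far ends are close in comparison with their lengths diverge
  hardly at all near the flat: by convexity of the metric, the influence of the far ends is
  proportional to the fraction \<open>s\<close> of the length that is travelled up to time \<open>t\<close>, which is at
  most \<open>t / (K * R)\<close>.
\<close>

lemma nearly_parallel_perpendiculars: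
  assumes x: "x' \<in> M" "geodesic_from_to M d (\<phi> x) x' c"
    and y: "y' \<in> M" "geodesic_from_to M d (\<phi> y) y' c'"
    and t: "0 \<le> t" and R: "1 \<le> R" and K: "1 \<le> K" "t \<le> K"
    and H: "K * R \<le> d (\<phi> x) x'" "K * R \<le> d (\<phi> y) y'"
    and close: "d x' y' \<le> R"
  shows "d (c t) (c' t) \<le> dist x y + (2 * t + t * dist x y) / K"
proof -
  let ?H = "d (\<phi> x) x'" and ?H' = "d (\<phi> y) y'"
  \<comment> \<open>convexity compares the points at equal fractions of the two lengths; the second
    estimate below corrects for the difference of the lengths\<close>
  define s where "s = t / ?H"
  have KR: "K \<le> K * R" using R K by simp
  have Hpos: "0 < ?H" "t \<le> ?H" "0 < ?H'" "t \<le> ?H'" using KR H K by linarith+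
  have s: "0 \<le> s" "s \<le> 1" "s * ?H = t" using Hpos t by (auto simp: s_def)
  have sR: "s * R \<le> t / K"
  proof -
    have "s * (K * R) \<le> s * ?H" using H s by (intro mult_left_mono) auto
    then show ?thesis using s(3) K by (simp add: pos_le_divide_eq mult_ac)
  qed
  have s_le: "s \<le> t / K"
  proof -
    have "s * 1 \<le> s * R" using R s by (intro mult_left_mono) auto
    then show ?thesis using sR by simp
  qed
  have sH': "s * ?H' \<in> {0..?H'}" using s Hpos by (auto intro: mult_left_le_one_le)
  note c = geodesic_from_toD(1,3,4)[OF x(2) t Hpos(2)]
  have c': "c' t \<in> M" "c' (s * ?H') \<in> M" "d (\<phi> y) (c' (s * ?H')) = s * ?H'"
    "d (c' (s * ?H')) y' = ?H' - s * ?H'" "d (c' (s * ?H')) (c' t) = \<bar>s * ?H' - t\<bar>"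
    using geodesic_from_toD(1)[OF y(2) t Hpos(4)] geodesic_from_toD[OF y(2), of "s * ?H'"]
      geodesic_from_toD(5)[OF y(2) t Hpos(4)] sH' by auto
  have "d (c t) (c' (s * ?H')) \<le> (1-s) * d (\<phi> x) (\<phi> y) + s * d x' y'"
    using c c' s x y by (intro convex_metric) (auto simp: left_diff_distrib)
  also have "\<dots> \<le> dist x y + s * R"
    using s close mult_right_mono[of "1-s" 1 "dist x y"] mult_left_mono[of "d x' y'" R s] by simp
  finally have 1: "d (c t) (c' (s * ?H')) \<le> dist x y + t / K" using sR by simp
  have "\<bar>?H' - ?H\<bar> \<le> dist x y + R"
    using triangle[of "\<phi> x" "\<phi> y" x'] triangle[of "\<phi> y" y' x'] triangle[of "\<phi> y" "\<phi> x" y']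
      triangle[of "\<phi> x" x' y'] x y close
    by (simp add: dist_commute commute[of y' x'] abs_le_iff)
  then have "s * \<bar>?H' - ?H\<bar> \<le> s * (dist x y + R)" using s by (intro mult_left_mono) auto
  moreover have "s * \<bar>?H' - ?H\<bar> = \<bar>s * ?H' - t\<bar>"
    using abs_mult[of s "?H' - ?H"] s by (simp add: right_diff_distrib)
  moreover have "s * dist x y \<le> t / K * dist x y" using s_le by (intro mult_right_mono) auto
  ultimately have 2: "d (c' (s * ?H')) (c' t) \<le> t / K * dist x y + t / K"
    using sR c' by (simp add: distrib_left)
  have "d (c t) (c' t) \<le> d (c t) (c' (s * ?H')) + d (c' (s * ?H')) (c' t)"
    using triangle c c' by blast
  also have "\<dots> \<le> dist x y + (2 * t + t * dist x y) / K"
    using 1 2 by (simp add: add_divide_distrib)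
  finally show ?thesis .
qed

text \<open>
  Each rectangle with one side on the flat is Euclidean: its diagonals are at least as long as in
  the plane because the rays are perpendicular to the flat, and at most as long by the quadrilateral
  inequality. The distance from a point on one ray to the points of another ray is then known at
  the bottom and at equal height, and comparison inequalities between these bound it from both
  sides elsewhere.
\<close>

lemma parallel_perpendicular_rays_span_half_flat:
  assumes Z: "\<And>x t. 0 \<le> t \<Longrightarrow> Z x t \<in> M" and Z0: "\<And>x. Z x 0 = \<phi> x"
    and ray: "\<And>x s t. 0 \<le> s \<Longrightarrow> 0 \<le> t \<Longrightarrow> d (Z x s) (Z x t) = \<bar>s - t\<bar>"
    and perp: "\<And>x w t. 0 \<le> t \<Longrightarrow> t\<^sup>2 + (dist x w)\<^sup>2 \<le> (d (Z x t) (\<phi> w))\<^sup>2"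
    and par: "\<And>x y t. 0 \<le> t \<Longrightarrow> d (Z x t) (Z y t) \<le> dist x y"
  shows "isometric_embedding (UNIV \<times> {0..}) M d (\<lambda>(x, t). Z x t)"
proof -
  have diag: "(d (\<phi> x) (Z y t))\<^sup>2 = t\<^sup>2 + (dist x y)\<^sup>2 \<and> d (Z x t) (Z y t) = dist x y" if t: "0 \<le> t" for x y t
  proof -
    have "(d (\<phi> x) (Z y t))\<^sup>2 + (d (\<phi> y) (Z x t))\<^sup>2
        \<le> (d (\<phi> x) (\<phi> y))\<^sup>2 + (d (\<phi> y) (Z y t))\<^sup>2 + (d (Z y t) (Z x t))\<^sup>2 + (d (Z x t) (\<phi> x))\<^sup>2"
      using t Z by (intro quadrilateral_inequality) auto
    moreover have "(d (\<phi> y) (Z y t))\<^sup>2 = t\<^sup>2" "(d (Z x t) (\<phi> x))\<^sup>2 = t\<^sup>2"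
      using ray[of 0 t y] ray[of t 0 x] t by (simp_all add: Z0)
    moreover have "(d (Z x t) (Z y t))\<^sup>2 \<le> (dist x y)\<^sup>2" using par[OF t] by (intro power_mono) auto
    moreover have "t\<^sup>2 + (dist x y)\<^sup>2 \<le> (d (\<phi> x) (Z y t))\<^sup>2" "t\<^sup>2 + (dist x y)\<^sup>2 \<le> (d (\<phi> y) (Z x t))\<^sup>2"
      using perp[OF t, of x y] perp[OF t, of y x] by (simp_all add: dist_commute commute)
    ultimately have "(d (\<phi> x) (Z y t))\<^sup>2 = t\<^sup>2 + (dist x y)\<^sup>2" "(dist x y)\<^sup>2 \<le> (d (Z x t) (Z y t))\<^sup>2"
      unfolding commute[of "Z y t" "Z x t"] flat_dist by linarith+
    then show ?thesis using par[OF t, of x y] power2_le_imp_le[of "dist x y" "d (Z x t) (Z y t)"] by simp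
  qed
  have CN: "(d p (Z x t))\<^sup>2 \<le> (1-t/s) * (d p (\<phi> x))\<^sup>2 + t/s * (d p (Z x s))\<^sup>2 - t/s*(1-t/s) * s\<^sup>2"
    if "0 \<le> t" "t \<le> s" "0 < s" "p \<in> M" for p x s t
  proof -
    have "d (\<phi> x) (Z x s) = s" "d (\<phi> x) (Z x t) = t"
      using ray[of 0 s x] ray[of 0 t x] that by (simp_all add: Z0)
    moreover have "d (Z x t) (Z x s) = s - t" using ray[of t s x] that by simp
    moreover have "s - t = (1-t/s) * s" using that by (simp add: field_simps)
    ultimately show ?thesis
      using CN_inequality[of "\<phi> x" "Z x s" "Z x t" p "t/s"] that Z by simp
  qed
  have le: "(d (Z x s) (Z y t))\<^sup>2 = (dist x y)\<^sup>2 + (s - t)\<^sup>2" if t: "0 \<le> t" "t \<le> s" for x y s t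
  proof (cases "t = 0")
    case True
    then show ?thesis using diag[of s y x] t by (simp add: Z0 dist_commute commute)
  next
    case False
    then have pos: "0 < t" "0 < s" using t by auto
    define r where "r = t/s"
    have r: "r * s = t" "0 < r" using pos by (auto simp: r_def)
    \<comment> \<open>lower bound: \<open>Z x t\<close> lies between \<open>\<phi> x\<close> and \<open>Z x s\<close>, and its distance to \<open>Z y t\<close> is known\<close>
    have "(d (Z y t) (Z x t))\<^sup>2 \<le> (1-r) * (d (Z y t) (\<phi> x))\<^sup>2 + r * (d (Z y t) (Z x s))\<^sup>2 - r*(1-r) * s\<^sup>2"
      unfolding r_def using CN t pos Z by auto
    then have "(dist x y)\<^sup>2 \<le> (1-r) * (t\<^sup>2 + (dist x y)\<^sup>2) + r * (d (Z x s) (Z y t))\<^sup>2 - r*(1-r) * s\<^sup>2"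
      using diag[of t x y] diag[of t y x] t by (simp add: commute dist_commute)
    moreover have "(1-r) * (t\<^sup>2 + (dist x y)\<^sup>2) - r*(1-r) * s\<^sup>2 = (dist x y)\<^sup>2 - r * ((dist x y)\<^sup>2 + (s - t)\<^sup>2)"
      unfolding r(1)[symmetric] by (simp add: power2_eq_square algebra_simps)
    ultimately have "r * ((dist x y)\<^sup>2 + (s - t)\<^sup>2) \<le> r * (d (Z x s) (Z y t))\<^sup>2" by linarith
    then have lower: "(dist x y)\<^sup>2 + (s - t)\<^sup>2 \<le> (d (Z x s) (Z y t))\<^sup>2" using r(2) by simp
    \<comment> \<open>upper bound: \<open>Z y t\<close> lies between \<open>\<phi> y\<close> and \<open>Z y s\<close>, whose distances to \<open>Z x s\<close> are known\<close>
    have "(d (Z x s) (Z y t))\<^sup>2 \<le> (1-r) * (d (Z x s) (\<phi> y))\<^sup>2 + r * (d (Z x s) (Z y s))\<^sup>2 - r*(1-r) * s\<^sup>2"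
      unfolding r_def using CN t pos Z by auto
    also have "\<dots> = (1-r) * (s\<^sup>2 + (dist x y)\<^sup>2) + r * (dist x y)\<^sup>2 - r*(1-r) * s\<^sup>2"
      using diag[of s x y] diag[of s y x] t by (simp add: commute dist_commute)
    also have "\<dots> = (dist x y)\<^sup>2 + (s - t)\<^sup>2"
      unfolding r(1)[symmetric] by (simp add: power2_eq_square algebra_simps)
    finally show ?thesis using lower by simp
  qed
  have "d (Z x s) (Z y t) = dist (x, s) (y, t)" if "0 \<le> s" "0 \<le> t" for x y s t
  proof -
    have "(d (Z x s) (Z y t))\<^sup>2 = (dist x y)\<^sup>2 + (s - t)\<^sup>2"
    proof (cases "t \<le> s")
      case False
      then show ?thesis using le[of s t y x] that
        by (simp add: commute[of "Z y t"] dist_commute[of y x] power2_commute[of t s])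
    qed (use le that in blast)
    then show ?thesis
      using real_sqrt_unique[of "d (Z x s) (Z y t)"] by (simp add: dist_Pair_Pair dist_real_def)
  qed
  then show ?thesis using Z unfolding isometric_embedding_def by auto
qed

text \<open>
  The perpendiculars to the flat at the points of a ball of radius \<open>n\<close>, of length at least \<open>n\<close>
  times the distance of their far ends, converge along the ultrafilter to perpendicular rays, since
  closed balls are compact. In the limit any two of these rays are parallel.
\<close>

theorem half_flat_of_distant_points:
  assumes \<omega>: "nonprincipal_ultrafilter (\<omega> :: nat filter)"
    and far: "\<And>n::nat. 1 \<le> n \<Longrightarrow> \<exists>R y. 1 \<le> R \<and> (\<forall>x. norm x \<le> n \<longrightarrow>
       y x \<in> M \<and> foot (y x) = x \<and> n * R \<le> d (\<phi> x) (y x) \<and> (\<forall>x'. norm x' \<le> n \<longrightarrow> d (y x) (y x') \<le> R))"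
  obtains \<psi> :: "'v \<times> real \<Rightarrow> 'a" where "isometric_embedding (UNIV \<times> {0..}) M d \<psi>" "\<And>x. \<psi> (x, 0) = \<phi> x"
proof -
  define Q where "Q n R y \<longleftrightarrow> 1 \<le> R \<and> (\<forall>x. norm x \<le> n \<longrightarrow>
       y x \<in> M \<and> foot (y x) = x \<and> n * R \<le> d (\<phi> x) (y x) \<and> (\<forall>x'. norm x' \<le> n \<longrightarrow> d (y x) (y x') \<le> R))"
    for n :: nat and R :: real and y :: "'v \<Rightarrow> 'a"
  have "\<exists>R y. Q n R y" if "1 \<le> n" for n
    using far[of n] that unfolding Q_def by simp
  then obtain R y where Q: "\<And>n. 1 \<le> n \<Longrightarrow> Q n (R n) (y n)" by metis
  have R: "1 \<le> R n" if "1 \<le> n" for n using Q[OF that] by (simp add: Q_def)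
  have y': "y n x \<in> M \<and> foot (y n x) = x \<and>
        n * R n \<le> d (\<phi> x) (y n x) \<and> (\<forall>x'. norm x' \<le> n \<longrightarrow> d (y n x) (y n x') \<le> R n)"
    if "1 \<le> n" "norm x \<le> real n" for n x
    using Q[OF that(1)] that(2) by (simp add: Q_def)
  have y: "y n x \<in> M" "foot (y n x) = x" "n * R n \<le> d (\<phi> x) (y n x)"
    "norm x' \<le> n \<Longrightarrow> d (y n x) (y n x') \<le> R n"
    if "1 \<le> n" "norm x \<le> real n" for n x x' using y'[OF that] by auto
  have "\<exists>c. geodesic_from_to M d (\<phi> x) (y n x) c" if "1 \<le> n" "norm x \<le> real n" for n and x :: 'v
    using CAT0 y(1)[OF that] flat_in unfolding CAT0_space_def geodesic_space_def by meson
  then obtain c where c: "\<And>n x. 1 \<le> n \<Longrightarrow> norm x \<le> real n \<Longrightarrow> geodesic_from_to M d (\<phi> x) (y n x) (c n x)"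
    by metis
  define good where "good n x t \<longleftrightarrow> 1 \<le> n \<and> norm x \<le> real n \<and> 0 \<le> t \<and> t \<le> real n" for n and x :: 'v and t :: real
  have H: "t \<le> d (\<phi> x) (y n x)" if "good n x t" for n x t
  proof -
    have "real n * 1 \<le> n * R n" using R that by (intro mult_left_mono) (auto simp: good_def)
    moreover have "n * R n \<le> d (\<phi> x) (y n x)" using y(3) that by (simp add: good_def)
    ultimately show ?thesis using that unfolding good_def by linarith
  qed
  have ev: "eventually (\<lambda>n. good n x t) \<omega>" if "0 \<le> t" for x t
  proof -
    have "eventually (\<lambda>n. n \<ge> nat \<lceil>1 + norm x + t\<rceil>) \<omega>" using \<omega> by (rule nonprincipal_ultrafilter_ge)
    then show ?thesis
    proof eventually_elim
      case (elim n)
      then have "1 + norm x + t \<le> real n" by linarith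
      then show ?case using that norm_ge_zero[of x] unfolding good_def by (auto simp: real_of_nat_ge_one_iff[symmetric] simp del: norm_ge_zero)
    qed
  qed
  have cray: "c n x t \<in> M \<and> c n x 0 = \<phi> x \<and> d (\<phi> x) (c n x t) = t" if "good n x t" for n x t
    using geodesic_from_toD(1-3)[OF c _ H[OF that]] that unfolding good_def by blast
  define Z where "Z x t = (SOME L. limitin mtopology (\<lambda>n. c n x t) L \<omega>)" for x t
  have Z: "limitin mtopology (\<lambda>n. c n x t) (Z x t) \<omega>" if "0 \<le> t" for x t
  proof -
    have "eventually (\<lambda>n. c n x t \<in> mcball (\<phi> x) t) \<omega>"
      using ev[OF that, of x] by eventually_elim (use cray in auto)
    then have "\<exists>L. limitin mtopology (\<lambda>n. c n x t) L \<omega>"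
      by (rule ultrafilter_limit_in_compact[OF \<omega> proper]) (rule exI)
    then show ?thesis unfolding Z_def by (rule someI_ex)
  qed
  have \<omega>0: "\<omega> \<noteq> bot" using \<omega> by (simp add: nonprincipal_ultrafilter_def)
  have lim: "((\<lambda>n. d (c n x s) (c n y t)) \<longlongrightarrow> d (Z x s) (Z y t)) \<omega>" if "0 \<le> s" "0 \<le> t" for x y s t
    by (rule tendsto_mdist[OF Z[OF that(1)] Z[OF that(2)]])
  have const: "limitin mtopology (\<lambda>n. \<phi> w) (\<phi> w) \<omega>" for w by (simp add: limitin_const_iff \<omega>0)
  have Z0: "Z x 0 = \<phi> x" for x
  proof -
    have "eventually (\<lambda>n. c n x 0 = \<phi> x) \<omega>"
      using ev[OF order_refl, of x] by eventually_elim (use cray in auto)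
    then have "limitin mtopology (\<lambda>n. \<phi> x) (Z x 0) \<omega>"
      using Z[of 0 x] limitin_transform_eventually by fastforce
    then show ?thesis using limitin_metric_unique[OF _ const \<omega>0] by blast
  qed
  have "isometric_embedding (UNIV \<times> {0..}) M d (\<lambda>(x, t). Z x t)"
  proof (rule parallel_perpendicular_rays_span_half_flat)
    show "Z x t \<in> M" if "0 \<le> t" for x t using Z[OF that] limitin_mspace by blast
    show "Z x 0 = \<phi> x" for x by (rule Z0)
    show "d (Z x s) (Z x t) = \<bar>s - t\<bar>" if st: "0 \<le> s" "0 \<le> t" for x s t
    proof (rule tendsto_unique[OF \<omega>0 lim[OF st]])
      have "eventually (\<lambda>n. d (c n x s) (c n x t) = \<bar>s - t\<bar>) \<omega>"
        using ev[OF st(1), of x] ev[OF st(2), of x]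
      proof eventually_elim
        case (elim n)
        then show ?case
          using geodesic_from_toD(5)[OF c st(2) H[OF elim(2)] st(1) H[OF elim(1)]] by (simp add: good_def)
      qed
      then show "((\<lambda>n. d (c n x s) (c n x t)) \<longlongrightarrow> \<bar>s - t\<bar>) \<omega>" by (rule tendsto_eventually)
    qed
    show "t\<^sup>2 + (dist x w)\<^sup>2 \<le> (d (Z x t) (\<phi> w))\<^sup>2" if t: "0 \<le> t" for x w t
    proof (rule tendsto_lowerbound[OF _ _ \<omega>0])
      show "((\<lambda>n. (d (c n x t) (\<phi> w))\<^sup>2) \<longlongrightarrow> (d (Z x t) (\<phi> w))\<^sup>2) \<omega>"
        using tendsto_mdist[OF Z[OF t] const] by (rule tendsto_power)
      show "eventually (\<lambda>n. t\<^sup>2 + (dist x w)\<^sup>2 \<le> (d (c n x t) (\<phi> w))\<^sup>2) \<omega>"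
        using ev[OF t, of x]
      proof eventually_elim
        case (elim n)
        then show ?case
          using foot_on_perpendicular[OF y(1,2) c, of n x t w] H[OF elim] by (auto simp: good_def)
      qed
    qed
    show "d (Z x t) (Z x' t) \<le> dist x x'" if t: "0 \<le> t" for x x' t
    proof (rule tendsto_le[OF \<omega>0 _ lim[OF t t]])
      have "((\<lambda>n. dist x x' + (2 * t + t * dist x x') * (1 / real n)) \<longlongrightarrow> dist x x' + (2 * t + t * dist x x') * 0) \<omega>"
        using nonprincipal_ultrafilter_le_sequentially[OF \<omega>] 
        by (intro tendsto_intros tendsto_mono[OF _ lim_1_over_n])
      then show "((\<lambda>n. dist x x' + (2 * t + t * dist x x') / real n) \<longlongrightarrow> dist x x') \<omega>" by simp
      show "eventually (\<lambda>n. d (c n x t) (c n x' t) \<le> dist x x' + (2 * t + t * dist x x') / real n) \<omega>"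
        using ev[OF t, of x] ev[OF t, of x']
      proof eventually_elim
        case (elim n)
        then have n: "1 \<le> n" "norm x \<le> real n" "norm x' \<le> real n" "t \<le> real n" "1 \<le> real n" by (auto simp: good_def)
        show ?case
          by (rule nearly_parallel_perpendiculars[OF y(1)[OF n(1,2)] c[OF n(1,2)] y(1)[OF n(1,3)] c[OF n(1,3)]
              t R[OF n(1)] n(5,4) y(3)[OF n(1,2)] y(3)[OF n(1,3)] y(4)[OF n(1,2,3)]])
      qed
    qed
  qed
  then show ?thesis by (rule that) (simp add: Z0)
qed

end

section \<open>The asymptotic cone\<close>

locale cone = Metric_space M d for M :: "'a set" and d +
  fixes b :: 'a and l :: "nat \<Rightarrow> real" and \<omega> :: "nat filter"
  assumes b: "b \<in> M" and l_pos: "\<And>j. 0 < l j" and l_top: "filterlim l at_top \<omega>"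
    and \<omega>: "nonprincipal_ultrafilter \<omega>"
begin

abbreviation seqs where "seqs \<equiv> cone_seqs M d b l \<omega>"
abbreviation cls where "cls x \<equiv> cone_rel M d b l \<omega> `` {x}"
abbreviation cone where "cone \<equiv> asymptotic_cone M d b l \<omega>"
abbreviation cdist where "cdist \<equiv> cone_dist d l \<omega>"
definition sdist where "sdist x y = enn2real (cone_seq_dist d l \<omega> x y)"

lemma \<omega>_not_bot: "\<omega> \<noteq> bot" using \<omega> by (simp add: nonprincipal_ultrafilter_def)

lemma seqs_in: "x \<in> seqs \<Longrightarrow> x j \<in> M"
  by (auto simp: cone_seqs_def)

lemma cone_seq_dist_tendsto:
  "((\<lambda>j. ennreal (d (x j) (y j) / l j)) \<longlongrightarrow> cone_seq_dist d l \<omega> x y) \<omega>"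
proof -
  obtain L where L: "((\<lambda>j. ennreal (d (x j) (y j) / l j)) \<longlongrightarrow> L) \<omega>"
    by (rule ultrafilter_tendsto_compact[OF \<omega>, of UNIV]) (auto simp: compact_UNIV)
  then show ?thesis unfolding cone_seq_dist_def using tendsto_Lim[OF \<omega>_not_bot L] by simp
qed

lemma eventually_bounded:
  assumes "cone_seq_dist d l \<omega> x y < \<infinity>"
  obtains K where "0 < K" "eventually (\<lambda>j. d (x j) (y j) / l j < K) \<omega>"
proof -
  obtain K where K: "cone_seq_dist d l \<omega> x y < ennreal K" "0 < K"
  proof -
    have "cone_seq_dist d l \<omega> x y < ennreal (enn2real (cone_seq_dist d l \<omega> x y) + 1)"
      using assms by (cases "cone_seq_dist d l \<omega> x y") (auto simp: ennreal_lessI)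
    moreover have "0 < enn2real (cone_seq_dist d l \<omega> x y) + 1"
      using enn2real_nonneg[of "cone_seq_dist d l \<omega> x y"] by linarith
    ultimately show thesis by (rule that)
  qed
  have "eventually (\<lambda>j. ennreal (d (x j) (y j) / l j) < ennreal K) \<omega>"
    by (rule order_tendstoD(2)[OF cone_seq_dist_tendsto K(1)])
  then have "eventually (\<lambda>j. d (x j) (y j) / l j < K) \<omega>"
    by eventually_elim (use l_pos in \<open>auto simp: ennreal_less_iff nonneg less_imp_le\<close>)
  then show ?thesis using K that by blast
qed

text \<open>
  With \<open>eventually_bounded\<close>, this translates between finite limits in \<open>ennreal\<close> and boundedness
  along the ultrafilter, so that the later proofs need real limits only.
\<close>

lemma cone_seq_dist_finite:
  assumes "eventually (\<lambda>j. d (x j) (y j) / l j \<le> K) \<omega>"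
  shows "cone_seq_dist d l \<omega> x y < \<infinity>"
proof -
  have "eventually (\<lambda>j. ennreal (d (x j) (y j) / l j) \<le> ennreal K) \<omega>"
    using assms by eventually_elim (rule ennreal_leI)
  then have "cone_seq_dist d l \<omega> x y \<le> ennreal K"
    by (rule tendsto_upperbound[OF cone_seq_dist_tendsto _ \<omega>_not_bot])
  then show ?thesis by (simp add: ennreal_less_top order_le_less_trans)
qed

lemma seqsI:
  assumes "\<And>j. x j \<in> M" "eventually (\<lambda>j. d (x j) b / l j \<le> K) \<omega>"
  shows "x \<in> seqs"
  unfolding cone_seqs_def using assms(1) cone_seq_dist_finite[OF assms(2)] by auto

lemma sdist_tendsto:
  assumes x: "x \<in> seqs" and y: "y \<in> seqs"
  shows "((\<lambda>j. d (x j) (y j) / l j) \<longlongrightarrow> sdist x y) \<omega>"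
    and "cone_seq_dist d l \<omega> x y = ennreal (sdist x y)"
proof -
  have "cone_seq_dist d l \<omega> x (\<lambda>_. b) < \<infinity>" using x by (simp add: cone_seqs_def)
  then obtain K where K: "eventually (\<lambda>j. d (x j) b / l j < K) \<omega>" by (rule eventually_bounded)
  have "cone_seq_dist d l \<omega> y (\<lambda>_. b) < \<infinity>" using y by (simp add: cone_seqs_def)
  then obtain K' where K': "eventually (\<lambda>j. d (y j) b / l j < K') \<omega>" by (rule eventually_bounded)
  have "eventually (\<lambda>j. d (x j) (y j) / l j \<le> K + K') \<omega>"
    using K K'
  proof eventually_elim
    case (elim j)
    have "d (x j) (y j) \<le> d (x j) b + d (y j) b" using triangle' seqs_in x y b by blast
    then have "d (x j) (y j) / l j \<le> d (x j) b / l j + d (y j) b / l j"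
      using l_pos[of j] by (simp add: divide_right_mono flip: add_divide_distrib)
    then show ?case using elim by simp
  qed
  then have fin: "cone_seq_dist d l \<omega> x y < \<infinity>" by (rule cone_seq_dist_finite)
  then show eq: "cone_seq_dist d l \<omega> x y = ennreal (sdist x y)" by (simp add: sdist_def)
  have "((\<lambda>j. ennreal (d (x j) (y j) / l j)) \<longlongrightarrow> ennreal (sdist x y)) \<omega>"
    using cone_seq_dist_tendsto eq by metis
  then show "((\<lambda>j. d (x j) (y j) / l j) \<longlongrightarrow> sdist x y) \<omega>"
    by (subst (asm) tendsto_ennreal_iff) (auto simp: sdist_def nonneg less_imp_le l_pos)
qed

lemma sdist_eqI:
  assumes "x \<in> seqs" "y \<in> seqs" "((\<lambda>j. d (x j) (y j) / l j) \<longlongrightarrow> r) \<omega>"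
  shows "sdist x y = r"
  using tendsto_unique[OF \<omega>_not_bot sdist_tendsto(1)] assms by blast

lemma sdist_nonneg: "0 \<le> sdist x y" by (simp add: sdist_def)

lemma sdist_commute: "sdist x y = sdist y x"
  by (simp add: sdist_def cone_seq_dist_def commute)

lemma sdist_refl: "x \<in> seqs \<Longrightarrow> sdist x x = 0"
  by (rule sdist_eqI) (auto simp: seqs_in)

lemma sdist_triangle:
  assumes "x \<in> seqs" "y \<in> seqs" "z \<in> seqs"
  shows "sdist x z \<le> sdist x y + sdist y z"
proof (rule tendsto_le[OF \<omega>_not_bot tendsto_add[OF sdist_tendsto(1) sdist_tendsto(1)] sdist_tendsto(1)])
  show "eventually (\<lambda>j. d (x j) (z j) / l j \<le> d (x j) (y j) / l j + d (y j) (z j) / l j) \<omega>"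
    using triangle seqs_in assms l_pos
    by (intro always_eventually) (simp add: divide_right_mono less_imp_le flip: add_divide_distrib)
qed (use assms in auto)

lemma cone_rel_iff: "(x, y) \<in> cone_rel M d b l \<omega> \<longleftrightarrow> x \<in> seqs \<and> y \<in> seqs \<and> sdist x y = 0"
  unfolding cone_rel_def using sdist_tendsto(2)[of x y] sdist_nonneg[of x y] by auto

lemma cone_rel_equiv: "equiv seqs (cone_rel M d b l \<omega>)"
proof (rule equivI)
  show "cone_rel M d b l \<omega> \<subseteq> seqs \<times> seqs" by (auto simp: cone_rel_iff)
  show "refl_on seqs (cone_rel M d b l \<omega>)" by (auto simp: refl_on_def cone_rel_iff sdist_refl)
  show "sym (cone_rel M d b l \<omega>)" by (auto simp: sym_def cone_rel_iff sdist_commute)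
  show "trans (cone_rel M d b l \<omega>)"
  proof (rule transI)
    fix x y z assume "(x, y) \<in> cone_rel M d b l \<omega>" "(y, z) \<in> cone_rel M d b l \<omega>"
    then show "(x, z) \<in> cone_rel M d b l \<omega>"
      using sdist_triangle[of x y z] sdist_nonneg[of x z] by (auto simp: cone_rel_iff)
  qed
qed

lemma cls_eq_iff: "x \<in> seqs \<Longrightarrow> y \<in> seqs \<Longrightarrow> cls x = cls y \<longleftrightarrow> sdist x y = 0"
  using eq_equiv_class_iff[OF cone_rel_equiv] cone_rel_iff by auto

lemma cls_in_cone: "x \<in> seqs \<Longrightarrow> cls x \<in> cone"
  unfolding asymptotic_cone_def by (rule quotientI)

lemma in_cls: "y \<in> cls x \<longleftrightarrow> x \<in> seqs \<and> y \<in> seqs \<and> sdist x y = 0"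
  by (simp add: cone_rel_iff)

lemma cone_member:
  assumes "A \<in> cone" "x \<in> A" shows "x \<in> seqs" "A = cls x"
proof -
  obtain y where "y \<in> seqs" "A = cls y" using assms(1) unfolding asymptotic_cone_def by (rule quotientE)
  then show "x \<in> seqs" "A = cls x" using assms(2) in_cls cls_eq_iff by auto
qed

lemma cone_nonempty: "A \<in> cone \<Longrightarrow> \<exists>x. x \<in> A"
  using in_quotient_imp_non_empty[OF cone_rel_equiv] unfolding asymptotic_cone_def by blast

lemma cdist_cls: assumes "x \<in> seqs" "y \<in> seqs" shows "cdist (cls x) (cls y) = sdist x y"
proof -
  have x': "(SOME x'. x' \<in> cls x) \<in> cls x" if "x \<in> seqs" for x
    by (rule someI[of _ x]) (simp add: cone_rel_iff that sdist_refl)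
  have "sdist x y = sdist x' y'" if "x' \<in> cls x" "y' \<in> cls y" for x' y'
  proof -
    have "x' \<in> seqs" "y' \<in> seqs" "sdist x x' = 0" "sdist y y' = 0" using that in_cls by auto
    then show ?thesis
      using sdist_triangle[of x x' y] sdist_triangle[of x' y' y] sdist_triangle[of x' x y'] sdist_triangle[of x y y']
        assms by (simp add: sdist_commute)
  qed
  then show ?thesis using x'[OF assms(1)] x'[OF assms(2)] unfolding cone_dist_def sdist_def by metis
qed

lemma cone_Metric_space: "Metric_space cone cdist"
proof
  show "0 \<le> cdist A B" for A B by (simp add: cone_dist_def)
  show "cdist A B = cdist B A" for A B by (simp add: cone_dist_def cone_seq_dist_def commute)
  fix A B assume "A \<in> cone" "B \<in> cone"
  then obtain x y where xy: "x \<in> seqs" "A = cls x" "y \<in> seqs" "B = cls y"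
    using cone_nonempty cone_member by metis
  then show "cdist A B = 0 \<longleftrightarrow> A = B" by (simp add: cdist_cls cls_eq_iff)
  fix C assume "C \<in> cone"
  then obtain z where "z \<in> seqs" "C = cls z" using cone_nonempty cone_member by metis
  then show "cdist A C \<le> cdist A B + cdist B C" using xy sdist_triangle by (simp add: cdist_cls)
qed

lemma tendsto_div_l: "((\<lambda>j. r / l j) \<longlongrightarrow> 0) \<omega>"
  by (rule real_tendsto_divide_at_top[OF tendsto_const l_top])

end

section \<open>The limit of a flat\<close>

locale cone_of_flat = proper_flat M d \<phi> + cone M d b l \<omega>
  for M :: "'a set" and d and \<phi> :: "'v::euclidean_space \<Rightarrow> 'a" and b l \<omega>
begin

text \<open>
  The factor \<open>l j\<close> on the parameter undoes the scaling of the metric, so this is an isometric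
  parametrisation of the limit flat.
\<close>

definition \<phi>\<omega> :: "'v \<Rightarrow> (nat \<Rightarrow> 'a) set" where "\<phi>\<omega> v = cls (\<lambda>j. \<phi> (l j *\<^sub>R v))"

lemma flat_seq:
  assumes "eventually (\<lambda>j. norm (v j) / l j \<le> K) \<omega>" shows "(\<lambda>j. \<phi> (v j)) \<in> seqs"
proof (rule seqsI)
  have "eventually (\<lambda>j. l j \<ge> 1) \<omega>" using l_top by (simp add: filterlim_at_top)
  then show "eventually (\<lambda>j. d (\<phi> (v j)) b / l j \<le> K + d (\<phi> 0) b) \<omega>" using assms
  proof eventually_elim
    case (elim j)
    have "d (\<phi> (v j)) b \<le> norm (v j) + d (\<phi> 0) b" using triangle[of "\<phi> (v j)" "\<phi> 0" b] b by simp
    then have "d (\<phi> (v j)) b / l j \<le> norm (v j) / l j + d (\<phi> 0) b / l j"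
      using elim by (simp add: divide_right_mono flip: add_divide_distrib)
    moreover have "d (\<phi> 0) b / l j \<le> d (\<phi> 0) b" using elim divide_left_mono[of 1 "l j" "d (\<phi> 0) b"] by simp
    ultimately show ?case using elim by simp
  qed
qed simp

lemma flat_seq_scale: "(\<lambda>j. \<phi> (l j *\<^sub>R v)) \<in> seqs"
  using l_pos by (intro flat_seq[of _ "norm v"]) (simp add: less_imp_le order_less_imp_not_eq2)

lemma \<phi>\<omega>_in_cone: "\<phi>\<omega> v \<in> cone"
  unfolding \<phi>\<omega>_def by (rule cls_in_cone[OF flat_seq_scale])

lemma flat_seq_limit:
  assumes v: "((\<lambda>j. v j /\<^sub>R l j) \<longlongrightarrow> p) \<omega>"
  shows "(\<lambda>j. \<phi> (v j)) \<in> seqs" "cls (\<lambda>j. \<phi> (v j)) = \<phi>\<omega> p"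
proof -
  have "((\<lambda>j. norm (v j /\<^sub>R l j)) \<longlongrightarrow> norm p) \<omega>" using v by (rule tendsto_norm)
  then have "eventually (\<lambda>j. norm (v j /\<^sub>R l j) < norm p + 1) \<omega>" by (rule order_tendstoD) simp
  then have "eventually (\<lambda>j. norm (v j) / l j \<le> norm p + 1) \<omega>"
    by eventually_elim (use l_pos in \<open>auto simp: divide_inverse mult.commute less_imp_le\<close>)
  then show s: "(\<lambda>j. \<phi> (v j)) \<in> seqs" by (rule flat_seq)
  have "((\<lambda>j. dist (v j /\<^sub>R l j) p) \<longlongrightarrow> 0) \<omega>" using v by (rule iffD1[OF tendsto_dist_iff])
  moreover have "dist (v j /\<^sub>R l j) p = d (\<phi> (v j)) (\<phi> (l j *\<^sub>R p)) / l j" for j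
  proof -
    have "v j /\<^sub>R l j - p = (v j - l j *\<^sub>R p) /\<^sub>R l j" using l_pos[of j] by (simp add: scaleR_diff_right)
    then show ?thesis using l_pos[of j] by (simp add: dist_norm divide_inverse mult.commute)
  qed
  ultimately have "sdist (\<lambda>j. \<phi> (v j)) (\<lambda>j. \<phi> (l j *\<^sub>R p)) = 0"
    by (intro sdist_eqI[OF s flat_seq_scale]) simp
  then show "cls (\<lambda>j. \<phi> (v j)) = \<phi>\<omega> p" unfolding \<phi>\<omega>_def
    using cls_eq_iff[OF s flat_seq_scale] by simp
qed

lemma \<phi>\<omega>_dist: "cdist (\<phi>\<omega> v) (\<phi>\<omega> w) = dist v w"
proof -
  have "d (\<phi> (l j *\<^sub>R v)) (\<phi> (l j *\<^sub>R w)) / l j = dist v w" for j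
    using l_pos[of j] by (simp add: dist_norm flip: scaleR_diff_right)
  then show ?thesis unfolding \<phi>\<omega>_def cdist_cls[OF flat_seq_scale flat_seq_scale]
    by (intro sdist_eqI flat_seq_scale) simp
qed

lemma bounded_flat_seq_limit:
  fixes v :: "nat \<Rightarrow> 'v"
  assumes "eventually (\<lambda>j. norm (v j) / l j \<le> K) \<omega>"
  obtains p where "((\<lambda>j. v j /\<^sub>R l j) \<longlongrightarrow> p) \<omega>"
proof -
  have "eventually (\<lambda>j. v j /\<^sub>R l j \<in> cball 0 K) \<omega>"
    using assms by eventually_elim (use l_pos in \<open>auto simp: divide_inverse mult.commute less_imp_le\<close>)
  then show ?thesis by (rule ultrafilter_tendsto_compact[OF \<omega> compact_cball]) (rule that)
qed

lemma seqs_foot_bounded: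
  assumes x: "x \<in> seqs"
  obtains K where "eventually (\<lambda>j. norm (foot (x j)) / l j \<le> K) \<omega>"
proof -
  have "(\<lambda>j. \<phi> 0) \<in> seqs" using flat_seq_scale[of 0] by simp
  then have "cone_seq_dist d l \<omega> x (\<lambda>j. \<phi> 0) < \<infinity>" using sdist_tendsto(2)[OF x] by simp
  then obtain K where K: "eventually (\<lambda>j. d (x j) (\<phi> 0) / l j < K) \<omega>" using eventually_bounded by blast
  then have "eventually (\<lambda>j. norm (foot (x j)) / l j \<le> K + K) \<omega>"
  proof eventually_elim
    case (elim j)
    have M: "x j \<in> M" using seqs_in x by blast
    have "norm (foot (x j)) \<le> d (x j) (\<phi> (foot (x j))) + d (x j) (\<phi> 0)"
      using triangle''[of "\<phi> (foot (x j))" "x j" "\<phi> 0"] M by simp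
    also have "\<dots> \<le> d (x j) (\<phi> 0) + d (x j) (\<phi> 0)" using foot_le[OF M] by simp
    finally have "norm (foot (x j)) / l j \<le> d (x j) (\<phi> 0) / l j + d (x j) (\<phi> 0) / l j"
      using l_pos[of j] by (simp add: divide_right_mono flip: add_divide_distrib)
    then show ?case using elim by simp
  qed
  then show ?thesis by (rule that)
qed

lemma cone_limit_flat: "cone_limit M d b l \<omega> (range \<phi>) = range \<phi>\<omega>"
proof (intro set_eqI iffI)
  fix A assume "A \<in> range \<phi>\<omega>"
  then obtain v where v: "A = \<phi>\<omega> v" by blast
  have *: "(\<lambda>j. \<phi> (l j *\<^sub>R v)) \<in> A" unfolding v \<phi>\<omega>_def in_cls using flat_seq_scale sdist_refl by blast
  then show "A \<in> cone_limit M d b l \<omega> (range \<phi>)"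
    unfolding cone_limit_def
  proof (intro CollectI conjI bexI[OF _ *])
    show "A \<in> cone" unfolding v by (rule \<phi>\<omega>_in_cone)
  qed auto
next
  fix A assume "A \<in> cone_limit M d b l \<omega> (range \<phi>)"
  then obtain x where x: "A \<in> cone" "x \<in> A" "range x \<subseteq> range \<phi>" unfolding cone_limit_def by blast
  have xs: "x \<in> seqs" "A = cls x" using cone_member x by auto
  have x_foot: "x j = \<phi> (foot (x j))" for j
  proof -
    obtain v where v: "x j = \<phi> v" using x by blast
    have "d (x j) (\<phi> (foot (x j))) \<le> d (x j) (\<phi> v)" using foot_le[of "x j" v] v flat_in by metis
    then have "dist v (foot (\<phi> v)) = 0" using v by simp
    then show ?thesis using v by simp
  qed
  obtain K where K: "eventually (\<lambda>j. norm (foot (x j)) / l j \<le> K) \<omega>" using seqs_foot_bounded xs by blast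
  obtain p where "((\<lambda>j. foot (x j) /\<^sub>R l j) \<longlongrightarrow> p) \<omega>" using bounded_flat_seq_limit[OF K] by blast
  then have "cls (\<lambda>j. \<phi> (foot (x j))) = \<phi>\<omega> p" by (rule flat_seq_limit)
  then show "A \<in> range \<phi>\<omega>" using xs x_foot by simp
qed

text \<open>
  The base point of the space need not lie on the flat, but its finite distance to \<open>\<phi> 0\<close> vanishes
  in the limit.
\<close>

lemma cone_base_flat: "cone_base M d b l \<omega> = \<phi>\<omega> 0"
proof -
  have "(\<lambda>_. b) \<in> seqs" using b by (intro seqsI[of _ 0]) auto
  moreover have "(\<lambda>_. \<phi> 0) \<in> seqs" using flat_seq_scale[of 0] by simp
  ultimately show ?thesis
    unfolding cone_base_def \<phi>\<omega>_def
    using cls_eq_iff sdist_eqI[OF _ _ tendsto_div_l] by simp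
qed

text \<open>
  Taking limits in the inequality of obtuse angles, the limit of the feet of a sequence satisfies
  it with respect to the limit flat; so it is the one and only nearest point there.
\<close>

lemma nearest_point_limit:
  assumes x: "x \<in> seqs"
  obtains p where "nearest_point cdist (range \<phi>\<omega>) (cls x) = \<phi>\<omega> p"
    "((\<lambda>j. foot (x j) /\<^sub>R l j) \<longlongrightarrow> p) \<omega>"
    "((\<lambda>j. d (x j) (\<phi> (foot (x j))) / l j) \<longlongrightarrow> cdist (cls x) (\<phi>\<omega> p)) \<omega>"
proof -
  obtain K where K: "eventually (\<lambda>j. norm (foot (x j)) / l j \<le> K) \<omega>" using seqs_foot_bounded x by blast
  obtain p where p: "((\<lambda>j. foot (x j) /\<^sub>R l j) \<longlongrightarrow> p) \<omega>" using bounded_flat_seq_limit[OF K] by blast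
  note pp = flat_seq_limit[OF p]
  have lim: "((\<lambda>j. d (x j) (\<phi> (foot (x j))) / l j) \<longlongrightarrow> cdist (cls x) (\<phi>\<omega> p)) \<omega>"
    using sdist_tendsto(1)[OF x pp(1)] cdist_cls[OF x pp(1)] pp(2) by simp
  have le: "(cdist (cls x) (\<phi>\<omega> p))\<^sup>2 + (dist p w)\<^sup>2 \<le> (cdist (cls x) (\<phi>\<omega> w))\<^sup>2" for w
  proof (rule tendsto_le[OF \<omega>_not_bot])
    show "((\<lambda>j. (d (x j) (\<phi> (l j *\<^sub>R w)) / l j)\<^sup>2) \<longlongrightarrow> (cdist (cls x) (\<phi>\<omega> w))\<^sup>2) \<omega>"
      unfolding \<phi>\<omega>_def cdist_cls[OF x flat_seq_scale]
      by (intro tendsto_power sdist_tendsto x flat_seq_scale)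
    show "((\<lambda>j. (d (x j) (\<phi> (foot (x j))) / l j)\<^sup>2 + (dist (foot (x j) /\<^sub>R l j) w)\<^sup>2)
        \<longlongrightarrow> (cdist (cls x) (\<phi>\<omega> p))\<^sup>2 + (dist p w)\<^sup>2) \<omega>"
      by (intro tendsto_intros lim p)
    have "(d (x j) (\<phi> (foot (x j))) / l j)\<^sup>2 + (dist (foot (x j) /\<^sub>R l j) w)\<^sup>2 \<le> (d (x j) (\<phi> (l j *\<^sub>R w)) / l j)\<^sup>2" for j
    proof -
      have "foot (x j) /\<^sub>R l j - w = (foot (x j) - l j *\<^sub>R w) /\<^sub>R l j"
        using l_pos[of j] by (simp add: scaleR_diff_right)
      then have "dist (foot (x j) /\<^sub>R l j) w = dist (foot (x j)) (l j *\<^sub>R w) / l j"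
        using l_pos[of j] by (simp add: dist_norm divide_inverse mult.commute)
      moreover have "(d (x j) (\<phi> (foot (x j))))\<^sup>2 + (dist (foot (x j)) (l j *\<^sub>R w))\<^sup>2 \<le> (d (x j) (\<phi> (l j *\<^sub>R w)))\<^sup>2"
        using foot_obtuse seqs_in x by blast
      moreover have "(p / l j)\<^sup>2 + (q / l j)\<^sup>2 \<le> (r / l j)\<^sup>2" if "p\<^sup>2 + q\<^sup>2 \<le> r\<^sup>2" for p q r
        using divide_right_mono[OF that, of "(l j)\<^sup>2"] by (simp add: power_divide add_divide_distrib)
      ultimately show ?thesis by simp
    qed
    then show "eventually (\<lambda>j. (d (x j) (\<phi> (foot (x j))) / l j)\<^sup>2 + (dist (foot (x j) /\<^sub>R l j) w)\<^sup>2
        \<le> (d (x j) (\<phi> (l j *\<^sub>R w)) / l j)\<^sup>2) \<omega>" by (simp add: always_eventually)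
  qed
  have cnn: "0 \<le> cdist A B" for A B by (simp add: cone_dist_def)
  have min: "cdist (cls x) (\<phi>\<omega> p) \<le> cdist (cls x) (\<phi>\<omega> w)" for w
  proof (rule power2_le_imp_le[OF _ cnn])
    show "(cdist (cls x) (\<phi>\<omega> p))\<^sup>2 \<le> (cdist (cls x) (\<phi>\<omega> w))\<^sup>2"
      using le[of w] zero_le_power2[of "dist p w"] by linarith
  qed
  have "nearest_point cdist (range \<phi>\<omega>) (cls x) = \<phi>\<omega> p"
  proof -
    have "is_arg_min (cdist (cls x)) (\<lambda>A. A \<in> range \<phi>\<omega>) (\<phi>\<omega> p)"
      using min by (auto simp: is_arg_min_def not_less)
    then have "is_arg_min (cdist (cls x)) (\<lambda>A. A \<in> range \<phi>\<omega>) (nearest_point cdist (range \<phi>\<omega>) (cls x))"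
      unfolding nearest_point_def arg_min_on_def arg_min_def by (rule someI)
    then obtain w where w: "nearest_point cdist (range \<phi>\<omega>) (cls x) = \<phi>\<omega> w"
      "cdist (cls x) (\<phi>\<omega> w) \<le> cdist (cls x) (\<phi>\<omega> p)"
      unfolding is_arg_min_def by (auto simp: not_less)
    then have "(cdist (cls x) (\<phi>\<omega> w))\<^sup>2 \<le> (cdist (cls x) (\<phi>\<omega> p))\<^sup>2" by (intro power_mono cnn)
    then have "(dist p w)\<^sup>2 \<le> 0" using le[of w] by linarith
    then show ?thesis using w by simp
  qed
  then show ?thesis using that p lim by blast
qed

end

section \<open>Essential maps of the sphere\<close>

text \<open>
  If the map extends over the disk, then two boundary points are joined by the image of the disk,
  and contracting the disk towards a boundary point \<open>p\<close> is a homotopy to a constant map that keeps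
  the value at \<open>p\<close>.
\<close>

lemma not_homotopically_nonzero_if_extends:
  fixes G :: "real^'k::finite \<Rightarrow> 'c::real_normed_vector"
  assumes G: "continuous_on (cball 0 1) G" "G ` cball 0 1 \<subseteq> A"
    and \<Phi>: "continuous_map (top_of_set A) Y \<Phi>"
    and g: "\<And>u. u \<in> sphere 0 1 \<Longrightarrow> g u = \<Phi> (G u)"
  shows "\<not> homotopically_nonzero Y g"
proof
  assume nz: "homotopically_nonzero Y g"
  have cont: "continuous_map (top_of_set (cball 0 1)) Y (\<Phi> \<circ> G)"
    using G by (intro continuous_map_compose[OF _ \<Phi>]) auto
  have sub: "sphere 0 1 \<subseteq> (cball 0 1 :: (real^'k) set)" by auto
  show False
  proof (cases "CARD('k) = 1")
    case True
    have "axis undefined 1 \<in> (sphere 0 1 :: (real^'k) set)" "- axis undefined 1 \<in> (sphere 0 1 :: (real^'k) set)"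
      by (simp_all add: norm_axis_1)
    moreover have "axis undefined 1 \<noteq> - (axis undefined 1 :: real^'k)"
      by (metis add.inverse_inverse axis_eq_0_iff eq_neg_iff_add_eq_0 scaleR_2 scaleR_eq_0_iff zero_neq_numeral zero_neq_one)
    moreover have "connected_component_of Y (g u) (g v)" if "u \<in> sphere 0 1" "v \<in> sphere 0 1" for u v
    proof -
      have "connectedin (top_of_set (cball 0 1)) (cball 0 1 :: (real^'k) set)"
        by (simp add: connectedin_subtopology convex_connected)
      then have "connectedin Y ((\<Phi> \<circ> G) ` cball 0 1)"
        by (rule connectedin_continuous_map_image[OF cont])
      moreover have "g u \<in> (\<Phi> \<circ> G) ` cball 0 1" "g v \<in> (\<Phi> \<circ> G) ` cball 0 1"
        using that sub g by auto
      ultimately show ?thesis unfolding connected_component_of_def by blast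
    qed
    ultimately show False using nz True unfolding homotopically_nonzero_def by metis
  next
    case False
    then obtain p where p: "p \<in> sphere 0 1"
      and np: "\<not> homotopic_with (\<lambda>h. h p = g p) (top_of_set (sphere 0 1)) Y g (\<lambda>_. g p)"
      using nz unfolding homotopically_nonzero_def by metis
    define c where "c = (\<lambda>(t::real, u). (1-t) *\<^sub>R u + t *\<^sub>R p)"
    have "c (t, u) \<in> cball 0 1" if "t \<in> {0..1}" "u \<in> sphere 0 1" for t u
      using convexD_alt[of "cball 0 1" u p t] that p by (simp add: c_def)
    then have "continuous_map (top_of_set ({0..1} \<times> sphere 0 1)) (top_of_set (cball 0 1)) c"
      by (auto simp: c_def case_prod_unfold intro!: continuous_intros)
    then have "continuous_map (prod_topology (top_of_set {0..1}) (top_of_set (sphere 0 1))) Y ((\<Phi> \<circ> G) \<circ> c)"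
      by (simp add: continuous_map_compose[OF _ cont])
    moreover have "((\<Phi> \<circ> G) \<circ> c) (0, u) = g u" "((\<Phi> \<circ> G) \<circ> c) (1, u) = g p" if "u \<in> sphere 0 1" for u
      using g[OF that] g[OF p] by (simp_all add: c_def)
    moreover have "((\<Phi> \<circ> G) \<circ> c) (t, p) = g p" for t
      using g[OF p] by (simp add: c_def algebra_simps)
    ultimately have "homotopic_with (\<lambda>h. h p = g p) (top_of_set (sphere 0 1)) Y g (\<lambda>_. g p)"
      using p by (subst homotopic_with) (auto intro!: exI[of _ "(\<Phi> \<circ> G) \<circ> c"])
    then show False using np by blast
  qed
qed

text \<open>
  The degree argument, without a degree: if \<open>h\<close> had no zero, its restriction to the sphere would
  be nullhomotopic in the punctured space, and so would be the nearby map \<open>P\<close>; hence \<open>P\<close> would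
  extend over the disk.
\<close>

lemma essential_boundary_imp_zero:
  fixes P h :: "real^'k::finite \<Rightarrow> 'c::real_normed_vector"
  assumes nz: "homotopically_nonzero Y g"
    and \<Phi>: "continuous_map (top_of_set (- {0})) Y \<Phi>"
    and g: "\<And>u. u \<in> sphere 0 1 \<Longrightarrow> g u = \<Phi> (P u)"
    and P: "continuous_on (sphere 0 1) P"
    and h: "continuous_on (cball 0 1) h"
    and near: "\<And>u. u \<in> sphere 0 1 \<Longrightarrow> dist (h u) (P u) < norm (P u)"
  shows "\<exists>u\<in>cball 0 1. h u = 0"
proof (rule ccontr)
  assume "\<not> ?thesis"
  then have "h ` cball 0 1 \<subseteq> - {0}" by auto
  then have "\<exists>c. homotopic_with_canon (\<lambda>x. True) (sphere 0 1) (- {0}) h (\<lambda>x. c)"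
    unfolding nullhomotopic_from_sphere_extension using h by blast
  then obtain c where c: "homotopic_with_canon (\<lambda>x. True) (sphere 0 1) (- {0}) h (\<lambda>x. c)" by blast
  have "homotopic_with_canon (\<lambda>x. True) (sphere 0 1) (- {0}) P h"
  proof (rule homotopic_with_linear[OF P])
    show "continuous_on (sphere 0 1) h" using h by (rule continuous_on_subset) auto
    show "closed_segment (P u) (h u) \<subseteq> - {0}" if "u \<in> sphere 0 1" for u
    proof
      fix x assume "x \<in> closed_segment (P u) (h u)"
      then have "dist x (P u) \<le> dist (h u) (P u)"
        using segment_bound(1)[of x "P u" "h u"] by (simp add: dist_norm)
      then show "x \<in> - {0}" using near[OF that] by (auto simp: dist_norm)
    qed
  qed
  then have "\<exists>c. homotopic_with_canon (\<lambda>x. True) (sphere 0 1) (- {0}) P (\<lambda>x. c)"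
    using c homotopic_with_trans by blast
  then obtain G where G: "continuous_on (cball 0 1) G" "G ` cball 0 1 \<subseteq> - {0}" "\<forall>u\<in>sphere 0 1. G u = P u"
    unfolding nullhomotopic_from_sphere_extension by blast
  have "g u = \<Phi> (G u)" if "u \<in> sphere 0 1" for u using g G(3) that by simp
  then show False using not_homotopically_nonzero_if_extends[OF G(1,2) \<Phi>] nz by blast
qed

section \<open>Descending from the cone to the space\<close>

context cone
begin

text \<open>
  Through this function on pairs, the theorems on continuous real functions on compact sets yield
  uniform continuity and boundedness for maps into the cone.
\<close>

lemma continuous_cdist:
  fixes f :: "'e::metric_space \<Rightarrow> (nat \<Rightarrow> 'a) set"
  assumes f: "continuous_map (top_of_set D) (Metric_space.mtopology cone cdist) f"
  shows "continuous_on (D \<times> D) (\<lambda>(u, v). cdist (f u) (f v))"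
proof -
  interpret C: Metric_space cone cdist by (rule cone_Metric_space)
  have f': "continuous_map (top_of_set D) (mtopology_of (metric (cone, cdist))) f" using f by simp
  have "continuous_map (top_of_set (D \<times> D)) (top_of_set D) fst"
    "continuous_map (top_of_set (D \<times> D)) (top_of_set D) snd"
    by (auto intro!: continuous_intros)
  from this[THEN continuous_map_compose[OF _ f']]
  have "continuous_map (top_of_set (D \<times> D)) euclidean (\<lambda>p. mdist (metric (cone, cdist)) ((f \<circ> fst) p) ((f \<circ> snd) p))"
    by (intro continuous_map_mdist)
  then show ?thesis by (simp add: case_prod_unfold)
qed

lemma uniformly_continuous_into_cone:
  fixes f :: "'e::metric_space \<Rightarrow> (nat \<Rightarrow> 'a) set"
  assumes f: "continuous_map (top_of_set D) (Metric_space.mtopology cone cdist) f"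
    and D: "compact D" and "0 < e"
  obtains \<delta> where "0 < \<delta>" "\<And>u v. u \<in> D \<Longrightarrow> v \<in> D \<Longrightarrow> dist u v < \<delta> \<Longrightarrow> cdist (f u) (f v) < e"
proof -
  interpret C: Metric_space cone cdist by (rule cone_Metric_space)
  have fD: "f u \<in> cone" if "u \<in> D" for u
    using continuous_map_funspace[OF f] that by auto
  have "uniformly_continuous_on (D \<times> D) (\<lambda>(u, v). cdist (f u) (f v))"
    using continuous_cdist[OF f] D by (intro compact_uniformly_continuous compact_Times)
  then obtain \<delta> where \<delta>: "0 < \<delta>" "\<And>x x'. x \<in> D \<times> D \<Longrightarrow> x' \<in> D \<times> D \<Longrightarrow> dist x' x < \<delta> \<Longrightarrow>
      dist ((\<lambda>(u, v). cdist (f u) (f v)) x') ((\<lambda>(u, v). cdist (f u) (f v)) x) < e"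
    unfolding uniformly_continuous_on_def using \<open>0 < e\<close> by metis
  have "cdist (f u) (f v) < e" if "u \<in> D" "v \<in> D" "dist u v < \<delta>" for u v
    using \<delta>(2)[of "(u, u)" "(u, v)"] that fD[OF that(1)]
    by (simp add: dist_Pair_Pair dist_commute dist_real_def)
  then show ?thesis using that \<delta>(1) by blast
qed

end

context cone_of_flat
begin

lemma flat_limit_continuous:
  "continuous_map (top_of_set (- {0})) 
     (subtopology (Metric_space.mtopology cone cdist) (range \<phi>\<omega> - {\<phi>\<omega> 0})) \<phi>\<omega>"
proof -
  interpret C: Metric_space cone cdist by (rule cone_Metric_space)
  have inj: "v = w" if "\<phi>\<omega> v = \<phi>\<omega> w" for v w
    using \<phi>\<omega>_dist[of v w] C.mdist_zero[OF \<phi>\<omega>_in_cone, of w] that by simp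
  have "continuous_map euclidean C.mtopology \<phi>\<omega>"
    unfolding C.continuous_map_to_metric
  proof (intro ballI allI impI)
    fix v :: 'v and e :: real assume "0 < e"
    then show "\<exists>U. openin euclidean U \<and> v \<in> U \<and> (\<forall>w\<in>U. \<phi>\<omega> w \<in> C.mball (\<phi>\<omega> v) e)"
      by (intro exI[of _ "ball v e"]) (auto simp: \<phi>\<omega>_in_cone \<phi>\<omega>_dist)
  qed
  then have "continuous_map (top_of_set (- {0})) C.mtopology \<phi>\<omega>"
    by (rule continuous_map_from_subtopology)
  then show ?thesis
    by (rule continuous_map_into_subtopology) (use inj in auto)
qed

lemma projected_point_limit:
  assumes A: "A \<in> cone" and x: "x \<in> A"
  obtains p where "nearest_point cdist (range \<phi>\<omega>) A = \<phi>\<omega> p"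
    "((\<lambda>j. foot (x j) /\<^sub>R l j) \<longlongrightarrow> p) \<omega>"
    "((\<lambda>j. d (x j) (\<phi> (foot (x j))) / l j) \<longlongrightarrow> cdist A (\<phi>\<omega> p)) \<omega>"
  by (rule nearest_point_limit[OF cone_member(1)[OF A x], folded cone_member(2)[OF A x]]) (rule that)

text \<open>
  Lift a fine net of the disk \<open>f\<close> in the cone to the \<open>j\<close>-th copy of \<open>M\<close>, for \<open>j\<close> in a set of
  the ultrafilter on which finitely many limits are nearly attained, and interpolate by barycentres
  to a continuous map \<open>F\<close> on the disk. Its scaled projection \<open>h\<close> to the flat is close to the
  projection \<open>P\<close> of \<open>f\<close>, hence still essential on the boundary around every point that is near the
  origin, so it attains all those points. As \<open>l j\<close> is large, they fill the ball of radius \<open>\<rho>\<close>.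
  It is the continuity of \<open>F\<close> that makes this exact: the feet of the lifted net alone leave gaps that
  are small compared with \<open>l j\<close>, but possibly unbounded.
\<close>

lemma distant_points_below_essential_disk:
  fixes f :: "real^'k::finite \<Rightarrow> (nat \<Rightarrow> 'a) set"
  assumes f: "continuous_map (top_of_set (cball 0 1)) (Metric_space.mtopology cone cdist) f"
    and diam: "\<And>u v. u \<in> cball 0 1 \<Longrightarrow> v \<in> cball 0 1 \<Longrightarrow> cdist (f u) (f v) \<le> 1"
    and height: "\<And>u v. u \<in> cball 0 1 \<Longrightarrow> K \<le> cdist (f u) (\<phi>\<omega> v)"
    and avoid: "\<phi>\<omega> 0 \<notin> (nearest_point cdist (range \<phi>\<omega>) \<circ> f) ` sphere 0 1"
    and essential: "homotopically_nonzero
       (subtopology (Metric_space.mtopology cone cdist) (range \<phi>\<omega> - {\<phi>\<omega> 0}))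
       (nearest_point cdist (range \<phi>\<omega>) \<circ> f)"
  shows "\<exists>R y. 1 \<le> R \<and> (\<forall>x. norm x \<le> \<rho> \<longrightarrow> y x \<in> M \<and> foot (y x) = x \<and>
      (K-1)/2 * R \<le> d (\<phi> x) (y x) \<and> (\<forall>x'. norm x' \<le> \<rho> \<longrightarrow> d (y x) (y x') \<le> R))"
proof -
  interpret C: Metric_space cone cdist by (rule cone_Metric_space)
  let ?D = "cball 0 1 :: (real^'k) set" and ?S = "sphere 0 1 :: (real^'k) set"
  have fD: "f u \<in> cone" if "u \<in> ?D" for u
    using continuous_map_funspace[OF f] that by auto
  define X where "X u = (SOME x. x \<in> f u)" for u
  have X: "X u \<in> f u" if "u \<in> ?D" for u
    unfolding X_def using cone_nonempty[OF fD[OF that]] by (rule someI_ex)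
  note Xs = cone_member[OF fD X]
  define Q where "Q u p \<longleftrightarrow> nearest_point cdist (range \<phi>\<omega>) (f u) = \<phi>\<omega> p \<and> ((\<lambda>j. foot (X u j) /\<^sub>R l j) \<longlongrightarrow> p) \<omega> \<and>
      ((\<lambda>j. d (X u j) (\<phi> (foot (X u j))) / l j) \<longlongrightarrow> cdist (f u) (\<phi>\<omega> p)) \<omega>" for u p
  have "\<exists>p. Q u p" if u: "u \<in> ?D" for u
    using projected_point_limit[OF fD[OF u] X[OF u]] unfolding Q_def by blast
  then obtain P where Q: "\<And>u. u \<in> ?D \<Longrightarrow> Q u (P u)" by metis
  have P: "nearest_point cdist (range \<phi>\<omega>) (f u) = \<phi>\<omega> (P u)"
    "((\<lambda>j. foot (X u j) /\<^sub>R l j) \<longlongrightarrow> P u) \<omega>"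
    "((\<lambda>j. d (X u j) (\<phi> (foot (X u j))) / l j) \<longlongrightarrow> cdist (f u) (\<phi>\<omega> (P u))) \<omega>" if "u \<in> ?D" for u
    using Q[OF that] by (auto simp: Q_def)
  have Xlim: "((\<lambda>j. d (X u j) (X v j) / l j) \<longlongrightarrow> cdist (f u) (f v)) \<omega>" if "u \<in> ?D" "v \<in> ?D" for u v
  proof -
    have "cdist (f u) (f v) = sdist (X u) (X v)"
      using cdist_cls[OF Xs(1)[OF that(1,1)] Xs(1)[OF that(2,2)]] Xs(2)[OF that(1,1)] Xs(2)[OF that(2,2)] by simp
    then show ?thesis using sdist_tendsto(1)[OF Xs(1)[OF that(1,1)] Xs(1)[OF that(2,2)]] by simp
  qed
  have scaled_foot: "dist (foot x /\<^sub>R L) (foot y /\<^sub>R L) \<le> d x y / L" if "x \<in> M" "y \<in> M" "0 < L" for x y L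
    using foot_Lipschitz[OF that(1,2)] that(3)
    by (simp add: dist_norm divide_inverse mult.commute flip: scaleR_diff_right)
  have PLip: "dist (P u) (P v) \<le> cdist (f u) (f v)" if uv: "u \<in> ?D" "v \<in> ?D" for u v
  proof (rule tendsto_le[OF \<omega>_not_bot Xlim[OF uv] tendsto_dist[OF P(2)[OF uv(1)] P(2)[OF uv(2)]]])
    show "eventually (\<lambda>j. dist (foot (X u j) /\<^sub>R l j) (foot (X v j) /\<^sub>R l j) \<le> d (X u j) (X v j) / l j) \<omega>"
      using scaled_foot seqs_in Xs(1) uv l_pos by (intro always_eventually allI) blast
  qed
  have contP: "continuous_on ?D P"
    unfolding continuous_on_iff
  proof (intro ballI allI impI)
    fix u and e :: real assume u: "u \<in> ?D" and "0 < e"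
    obtain \<delta> where "0 < \<delta>" "\<And>u v. u \<in> ?D \<Longrightarrow> v \<in> ?D \<Longrightarrow> dist u v < \<delta> \<Longrightarrow> cdist (f u) (f v) < e"
      using uniformly_continuous_into_cone[OF f compact_cball \<open>0 < e\<close>] by blast
    then show "\<exists>\<delta>>0. \<forall>v\<in>?D. dist v u < \<delta> \<longrightarrow> dist (P v) (P u) < e"
      using PLip u by (meson le_less_trans)
  qed
  have P_nz: "P u \<noteq> 0" if "u \<in> ?S" for u
  proof
    assume "P u = 0"
    then have "(nearest_point cdist (range \<phi>\<omega>) \<circ> f) u = \<phi>\<omega> 0" using P(1)[of u] that by simp
    then show False using avoid that by (metis image_eqI)
  qed
  have "?S \<subseteq> ?D" by auto
  then have contPS: "continuous_on ?S P" using contP continuous_on_subset by blast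
  obtain \<mu> where \<mu>: "0 < \<mu>" "\<And>u. u \<in> ?S \<Longrightarrow> \<mu> \<le> norm (P u)"
  proof -
    have "?S \<noteq> {}" by simp
    then obtain u where "u \<in> ?S" "\<And>v. v \<in> ?S \<Longrightarrow> norm (P u) \<le> norm (P v)"
      using continuous_attains_inf[OF compact_sphere _ continuous_on_norm[OF contPS]] by blast
    then show thesis using that[of "norm (P u)"] P_nz by simp
  qed
  \<comment> \<open>\<open>h\<close> will be within \<open>4 * e\<close> of \<open>P\<close>, a translation by another \<open>e\<close> has to be absorbed by \<open>\<mu>\<close>,
    and the diameter \<open>1 + 5 * e\<close> must not exceed \<open>2\<close>\<close>
  define e where "e = min (1/8) (\<mu>/6)"
  have e: "0 < e" "e \<le> 1/8" "5 * e < \<mu>" using \<mu> by (auto simp: e_def)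
  obtain \<delta> where \<delta>: "0 < \<delta>" "\<And>u v. u \<in> ?D \<Longrightarrow> v \<in> ?D \<Longrightarrow> dist u v < \<delta> \<Longrightarrow> cdist (f u) (f v) < e"
    using uniformly_continuous_into_cone[OF f compact_cball e(1)] by blast
  \<comment> \<open>two net points near a common point have distance less than \<open>\<delta>\<close>\<close>
  define \<delta>' where "\<delta>' = \<delta>/2"
  have \<delta>': "0 < \<delta>'" using \<delta> by (simp add: \<delta>'_def)
  have "seq_compact ?D" by (intro compact_imp_seq_compact compact_cball)
  from seq_compact_imp_totally_bounded[OF this, THEN spec, THEN mp, OF \<delta>']
  obtain N where N: "finite N" "N \<subseteq> ?D" "?D \<subseteq> (\<Union>n\<in>N. ball n \<delta>')"
    by (elim exE conjE)
  have ND: "n \<in> ?D" if "n \<in> N" for n using N(2) that by blast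
  have cover: "\<exists>n\<in>N. dist u n < \<delta>'" if u: "u \<in> ?D" for u
  proof -
    obtain n where "n \<in> N" "u \<in> ball n \<delta>'" using subsetD[OF N(3) u] by blast
    then show ?thesis by (auto simp: dist_commute)
  qed
  define good where "good j \<longleftrightarrow>
     (\<forall>n\<in>N. \<forall>n'\<in>N. d (X n j) (X n' j) / l j < cdist (f n) (f n') + e) \<and>
     (\<forall>n\<in>N. K - e < d (X n j) (\<phi> (foot (X n j))) / l j) \<and>
     (\<forall>n\<in>N. dist (foot (X n j) /\<^sub>R l j) (P n) < e) \<and> max 1 (\<rho>/e) \<le> l j" for j
  have "eventually (\<lambda>j. \<forall>n\<in>N. \<forall>n'\<in>N. d (X n j) (X n' j) / l j < cdist (f n) (f n') + e) \<omega>"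
    by (intro eventually_ball_finite ballI N(1) order_tendstoD(2)[OF Xlim]) (use ND e in auto)
  moreover have "eventually (\<lambda>j. \<forall>n\<in>N. K - e < d (X n j) (\<phi> (foot (X n j))) / l j) \<omega>"
  proof (intro eventually_ball_finite ballI N(1))
    fix n assume "n \<in> N"
    then have "K \<le> cdist (f n) (\<phi>\<omega> (P n))" using height ND by blast
    then have "K - e < cdist (f n) (\<phi>\<omega> (P n))" using e by linarith
    then show "eventually (\<lambda>j. K - e < d (X n j) (\<phi> (foot (X n j))) / l j) \<omega>"
      by (rule order_tendstoD(1)[OF P(3)[OF ND[OF \<open>n \<in> N\<close>]]])
  qed
  moreover have "eventually (\<lambda>j. \<forall>n\<in>N. dist (foot (X n j) /\<^sub>R l j) (P n) < e) \<omega>"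
    by (intro eventually_ball_finite ballI N(1) tendstoD[OF P(2) e(1)] ND)
  moreover have "eventually (\<lambda>j. max 1 (\<rho>/e) \<le> l j) \<omega>"
    using l_top unfolding filterlim_at_top by (rule spec)
  ultimately have "eventually good \<omega>" unfolding good_def by eventually_elim blast
  then obtain j where "good j" using eventually_happens'[OF \<omega>_not_bot] by blast
  then have j: "\<And>n n'. n \<in> N \<Longrightarrow> n' \<in> N \<Longrightarrow> d (X n j) (X n' j) / l j < cdist (f n) (f n') + e"
    "\<And>n. n \<in> N \<Longrightarrow> K - e < d (X n j) (\<phi> (foot (X n j))) / l j"
    "\<And>n. n \<in> N \<Longrightarrow> dist (foot (X n j) /\<^sub>R l j) (P n) < e" "1 \<le> l j" "\<rho>/e \<le> l j"
    unfolding good_def by simp_all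
  define L where "L = l j"
  define z where "z n = X n j" for n
  have L: "0 < L" "1 \<le> L" "\<rho> \<le> e * L" using j e l_pos by (auto simp: L_def pos_divide_le_eq mult.commute)
  have zM: "z n \<in> M" if "n \<in> N" for n using seqs_in[OF Xs(1)[OF ND[OF that] ND[OF that]]] by (simp add: z_def)
  have z_dist: "d (z n) (z n') < (cdist (f n) (f n') + e) * L" if "n \<in> N" "n' \<in> N" for n n'
    using j(1)[OF that] L(1) by (simp add: z_def L_def pos_divide_less_eq)
  have z_height: "(K - e) * L \<le> d (z n) (\<phi> w)" if "n \<in> N" for n w
    using j(2)[OF that] L(1) foot_le[OF zM[OF that], of w] by (simp add: z_def L_def pos_less_divide_eq)
  obtain F where F: "\<forall>u\<in>?D. F u \<in> M"
    "\<forall>u\<in>?D. \<forall>p\<in>M. \<forall>e\<ge>0. (\<forall>n\<in>N. dist u n < \<delta>' \<longrightarrow> d p (z n) \<le> e) \<longrightarrow> d (F u) p \<le> e"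
    "\<forall>u\<in>?D. ((\<lambda>v. d (F u) (F v)) \<longlongrightarrow> 0) (at u within ?D)"
    using continuous_interpolation[of N z \<delta>' ?D, OF N(1) zM \<delta>' cover] by blast
  have FM: "F u \<in> M" if "u \<in> ?D" for u using F(1) that by blast
  have Fz: "d (F u) (z n) \<le> 2 * e * L" if u: "u \<in> ?D" and n: "n \<in> N" "dist u n < \<delta>'" for u n
  proof -
    have "d (z n) (z n') \<le> 2 * e * L" if n': "n' \<in> N" "dist u n' < \<delta>'" for n'
    proof -
    have "dist n n' < \<delta>" using dist_triangle2[of n n' u] n n' by (simp add: \<delta>'_def dist_commute)
    then have "cdist (f n) (f n') < e" using \<delta>(2) ND n n' by blast
    then have "(cdist (f n) (f n') + e) * L \<le> (2 * e) * L" using L by (intro mult_right_mono) auto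
    then show ?thesis using z_dist[OF n(1) n'(1)] by simp
    qed
    moreover have "0 \<le> 2 * e * L" using e L by simp
    ultimately show ?thesis using F(2) u zM[OF n(1)] by blast
  qed
  define h where "h u = foot (F u) /\<^sub>R L" for u
  have hLip: "dist (h u) (h v) \<le> d (F u) (F v) / L" if "u \<in> ?D" "v \<in> ?D" for u v
    unfolding h_def using scaled_foot FM that L(1) by blast
  have conth: "continuous_on ?D h"
    unfolding continuous_on_def
  proof
    fix u assume u: "u \<in> ?D"
    have "((\<lambda>v. d (F u) (F v) / L) \<longlongrightarrow> 0 / L) (at u within ?D)"
      using F(3) u L by (intro tendsto_divide tendsto_const) auto
    then have lim: "((\<lambda>v. d (F u) (F v) / L) \<longlongrightarrow> 0) (at u within ?D)" by simp
    have ev: "eventually (\<lambda>v. dist (h v) (h u) \<le> d (F u) (F v) / L) (at u within ?D)"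
      unfolding eventually_at_filter using hLip[OF u] by (auto simp: dist_commute)
    have "((\<lambda>v. dist (h v) (h u)) \<longlongrightarrow> 0) (at u within ?D)"
      by (rule tendsto_sandwich[OF _ ev tendsto_const lim]) auto
    then show "(h \<longlongrightarrow> h u) (at u within ?D)" by (subst tendsto_dist_iff)
  qed
  have hP: "dist (h u) (P u) < 4 * e" if u: "u \<in> ?D" for u
  proof -
    obtain n where n: "n \<in> N" "dist u n < \<delta>'" using cover[OF u] by blast
    have "dist (h u) (foot (z n) /\<^sub>R L) \<le> d (F u) (z n) / L"
      unfolding h_def using scaled_foot FM[OF u] zM[OF n(1)] L(1) by blast
    also have "\<dots> \<le> 2 * e" using Fz[OF u n] L(1) by (simp add: pos_divide_le_eq)
    finally have 1: "dist (h u) (foot (z n) /\<^sub>R L) \<le> 2 * e" .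
    have 2: "dist (foot (z n) /\<^sub>R L) (P n) < e" using j(3)[OF n(1)] by (simp add: z_def L_def)
    have "cdist (f n) (f u) < e" using \<delta> n ND[OF n(1)] u by (simp add: \<delta>'_def dist_commute)
    then have 3: "dist (P n) (P u) < e" using PLip[OF ND[OF n(1)] u] by linarith
    show ?thesis
      using dist_triangle[of "h u" "P u" "foot (z n) /\<^sub>R L"] dist_triangle[of "foot (z n) /\<^sub>R L" "P u" "P n"] 1 2 3
      by linarith
  qed
  have "\<exists>u\<in>?D. foot (F u) = x" if x: "norm x \<le> \<rho>" for x
  proof -
    have "norm x / L \<le> e" using x L by (simp add: pos_divide_le_eq)
    then have xe: "norm (x /\<^sub>R L) \<le> e" using L(1) by (simp add: divide_inverse mult.commute)
    have "\<exists>u\<in>?D. h u - x /\<^sub>R L = 0"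
    proof (rule essential_boundary_imp_zero[OF essential flat_limit_continuous _ contPS])
      show "(nearest_point cdist (range \<phi>\<omega>) \<circ> f) u = \<phi>\<omega> (P u)" if "u \<in> ?S" for u
        using P(1) that by simp
      show "continuous_on ?D (\<lambda>u. h u - x /\<^sub>R L)" by (intro continuous_intros conth)
      show "dist (h u - x /\<^sub>R L) (P u) < norm (P u)" if "u \<in> ?S" for u
      proof -
        have "dist (h u - x /\<^sub>R L) (P u) \<le> dist (h u) (P u) + norm (x /\<^sub>R L)"
          unfolding dist_norm using norm_triangle_ineq4[of "h u - P u" "x /\<^sub>R L"] by (simp add: algebra_simps)
        also have "\<dots> < 5 * e" using hP[of u] xe that by simp
        finally show ?thesis using e(3) \<mu>(2)[OF that] by linarith
      qed
    qed
    then show ?thesis using L(1) by (auto simp: h_def)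
  qed
  then obtain U where U: "\<And>x. norm x \<le> \<rho> \<Longrightarrow> U x \<in> ?D \<and> foot (F (U x)) = x" by metis
  show ?thesis
  proof (intro exI conjI allI impI)
    \<comment> \<open>twice the scale bounds the diameter of the image of \<open>F\<close>\<close>
    show "1 \<le> 2 * L" using L by simp
    fix x :: 'v assume x: "norm x \<le> \<rho>"
    show "F (U x) \<in> M" "foot (F (U x)) = x" using U[OF x] FM by auto
    obtain n where n: "n \<in> N" "dist (U x) n < \<delta>'" using cover U[OF x] by blast
    have Fn: "d (F (U x)) (z n) \<le> 2 * e * L" using Fz n U[OF x] by blast
    have Fx: "F (U x) \<in> M" using U[OF x] FM by blast
    have "d (z n) (\<phi> x) \<le> d (F (U x)) (z n) + d (\<phi> x) (F (U x))"
      using triangle''[of "z n" "F (U x)" "\<phi> x"] zM n Fx by (simp add: commute[of _ "\<phi> x"])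
    then have "(K - 3 * e) * L \<le> d (\<phi> x) (F (U x))"
      using z_height[OF n(1), of x] Fn by (simp add: algebra_simps)
    moreover have "(K - 1) * L \<le> (K - 3 * e) * L" using L e by (intro mult_right_mono) auto
    ultimately show "(K-1)/2 * (2 * L) \<le> d (\<phi> x) (F (U x))" by simp
    fix x' :: 'v assume x': "norm x' \<le> \<rho>"
    obtain n' where n': "n' \<in> N" "dist (U x') n' < \<delta>'" using cover U[OF x'] by blast
    have Fn': "d (F (U x')) (z n') \<le> 2 * e * L" using Fz n' U[OF x'] by blast
    have Fx': "F (U x') \<in> M" using U[OF x'] FM by blast
    have "cdist (f n) (f n') \<le> 1" using diam ND n n' by blast
    then have "(cdist (f n) (f n') + e) * L \<le> (1 + e) * L" using L by (intro mult_right_mono) auto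
    then have "d (z n) (z n') \<le> (1 + e) * L" using z_dist[OF n(1) n'(1)] by linarith
    moreover have "d (F (U x)) (F (U x')) \<le> d (F (U x)) (z n) + (d (z n) (z n') + d (F (U x')) (z n'))"
      using triangle[of "F (U x)" "z n" "F (U x')"] triangle'[of "z n" "z n'" "F (U x')"] zM n n' Fx Fx' by simp
    ultimately have "d (F (U x)) (F (U x')) \<le> (1 + 5 * e) * L" using Fn Fn' by (simp add: algebra_simps)
    also have "\<dots> \<le> 2 * L" using e L by (intro mult_right_mono) auto
    finally show "d (F (U x)) (F (U x')) \<le> 2 * L" .
  qed
qed

end

section \<open>Flattening sequences yield half-flats\<close>

theorem theoremA:
  fixes M :: "'a set" and d :: "'a \<Rightarrow> 'a \<Rightarrow> real" and b :: 'a
    and l :: "nat \<Rightarrow> real" and \<omega> :: "nat filter" and \<gamma> :: "'a set"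
  assumes "CAT0_space M d" and "Metric_space.mcomplete M d"
    and "locally_compact_space (Metric_space.mtopology M d)"
    and "nonprincipal_ultrafilter \<omega>" and "b \<in> M"
    and "\<And>j. 0 < l j" and "filterlim l at_top \<omega>"
    and "is_flat TYPE('k::finite) M d \<gamma>"
    and "\<exists>f :: nat \<Rightarrow> real^'k \<Rightarrow> (nat \<Rightarrow> 'a) set.
           flattening_sequence (asymptotic_cone M d b l \<omega>) (cone_dist d l \<omega>) (cone_base M d b l \<omega>)
             (cone_limit M d b l \<omega> \<gamma>) f"
  shows "bounds_half_flat TYPE('k) M d \<gamma>"
proof -
  obtain \<phi> :: "real^'k \<Rightarrow> 'a" where \<phi>: "isometric_embedding UNIV M d \<phi>" "range \<phi> = \<gamma>"
    using assms(8) unfolding is_flat_def by blast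
  interpret Metric_space M d
    using assms(1) unfolding CAT0_space_def geodesic_space_def by blast
  interpret CAT0 M d by unfold_locales (rule assms(1))
  interpret cone_of_flat M d \<phi> b l \<omega>
    by unfold_locales (use Hopf_Rinow assms \<phi> in auto)
  interpret C: Metric_space cone cdist by (rule cone_Metric_space)
  let ?\<pi> = "nearest_point cdist (range \<phi>\<omega>)" and ?D = "cball 0 1 :: (real^'k) set"
  have base: "cone_base M d b l \<omega> = \<phi>\<omega> 0" and limit: "cone_limit M d b l \<omega> \<gamma> = range \<phi>\<omega>"
    using cone_base_flat cone_limit_flat \<phi>(2) by auto
  obtain f :: "nat \<Rightarrow> real^'k \<Rightarrow> (nat \<Rightarrow> 'a) set" where
    "flattening_sequence cone cdist (\<phi>\<omega> 0) (range \<phi>\<omega>) f"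
    using assms(9) unfolding base limit by blast
  then obtain C where "0 < C"
    and f: "\<And>r. continuous_map (top_of_set ?D) C.mtopology (f r)"
      "\<And>r. (SUP (u, v)\<in>?D \<times> ?D. cdist (f r u) (f r v)) < 1"
      "\<And>r. \<phi>\<omega> 0 \<notin> (?\<pi> \<circ> f r) ` sphere 0 1"
      "\<And>r. homotopically_nonzero (subtopology C.mtopology (range \<phi>\<omega> - {\<phi>\<omega> 0})) (?\<pi> \<circ> f r)"
      "\<And>r. C * real r \<le> (INF u\<in>?D. INF p\<in>range \<phi>\<omega>. cdist (f r u) p)"
    unfolding flattening_sequence_def Let_def by metis
  have diam: "cdist (f r u) (f r v) \<le> 1" if "u \<in> ?D" "v \<in> ?D" for r u v
  proof -
    let ?S = "(\<lambda>(u, v). cdist (f r u) (f r v)) ` (?D \<times> ?D)"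
    have "compact ?S"
      by (intro compact_continuous_image continuous_cdist[OF f(1)] compact_Times compact_cball)
    then have "bdd_above ?S" by (intro bounded_imp_bdd_above compact_imp_bounded)
    moreover have "cdist (f r u) (f r v) \<in> ?S" using that by (intro image_eqI[of _ _ "(u, v)"]) auto
    ultimately have "cdist (f r u) (f r v) \<le> Sup ?S" by (intro cSup_upper)
    then show ?thesis using f(2)[of r] by linarith
  qed
  have height: "C * real r \<le> cdist (f r u) (\<phi>\<omega> v)" if u: "u \<in> ?D" for r u v
  proof -
    have bdd: "bdd_below ((\<lambda>p. cdist (f r u) p) ` range \<phi>\<omega>)" for u
      by (intro bdd_belowI2[of _ 0] C.nonneg)
    have "bdd_below ((\<lambda>u. INF p\<in>range \<phi>\<omega>. cdist (f r u) p) ` ?D)"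
      by (intro bdd_belowI2[of _ 0] cINF_greatest C.nonneg) auto
    then have "(INF u\<in>?D. INF p\<in>range \<phi>\<omega>. cdist (f r u) p) \<le> (INF p\<in>range \<phi>\<omega>. cdist (f r u) p)"
      by (rule cINF_lower[OF _ u])
    also have "\<dots> \<le> cdist (f r u) (\<phi>\<omega> v)" by (rule cINF_lower[OF bdd]) auto
    finally show ?thesis using f(5)[of r] by linarith
  qed
  have far: "\<exists>R y. 1 \<le> R \<and> (\<forall>x. norm x \<le> n \<longrightarrow> y x \<in> M \<and> foot (y x) = x \<and>
      real n * R \<le> d (\<phi> x) (y x) \<and> (\<forall>x'. norm x' \<le> n \<longrightarrow> d (y x) (y x') \<le> R))" for n :: nat
  proof -
    \<comment> \<open>the height \<open>C * r\<close> of the disk loses \<open>1\<close> and is halved when it is compared with the diameter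
      in \<open>M\<close>\<close>
    obtain r :: nat where "2 * real n + 1 \<le> real r * C"
      using reals_Archimedean3[OF \<open>0 < C\<close>] less_imp_le by metis
    then have n: "real n \<le> (C * real r - 1) / 2" by (simp add: mult.commute)
    obtain R y where R: "1 \<le> R"
      and y: "\<And>x. norm x \<le> n \<Longrightarrow> y x \<in> M \<and> foot (y x) = x \<and>
        (C * real r - 1)/2 * R \<le> d (\<phi> x) (y x) \<and> (\<forall>x'. norm x' \<le> n \<longrightarrow> d (y x) (y x') \<le> R)"
      using distant_points_below_essential_disk[where \<rho> = "real n", OF f(1)[of r] diam height f(3,4)]
      by blast
    have "real n * R \<le> (C * real r - 1)/2 * R" using n R by (intro mult_right_mono) auto
    then have nR: "real n * R \<le> d (\<phi> x) (y x)" if "norm x \<le> n" for x using y[OF that] by linarith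
    show ?thesis
    proof (intro exI[of _ R] exI[of _ y] conjI allI impI R nR)
    qed (use y in auto)
  qed
  obtain \<psi> :: "(real^'k) \<times> real \<Rightarrow> 'a" where
    \<psi>: "isometric_embedding (UNIV \<times> {0..}) M d \<psi>" "\<And>x. \<psi> (x, 0) = \<phi> x"
    using half_flat_of_distant_points[OF assms(4) far] by blast
  have "\<psi> ` (UNIV \<times> {0}) = \<gamma>" using \<psi>(2) \<phi>(2) by (auto simp: image_iff)
  then show ?thesis unfolding bounds_half_flat_def using \<psi>(1) by blast
qed

end
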